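(* Let $V:\mathbb{R}\to\mathbb{R}$ be a continuous function with $\liminf_{|x|\to\infty} V(x)/x^2>0$. Then there exists a (finite) constant $B_V$ such that, for any probability measure $\nu$ on $\mathbb{R}$, $$W_1^2(\nu,\mu_V)\le B_V\,\Sigma_V(\nu).$$
   Context: $\mathcal{P}(\mathbb{R})$ is the set of Borel probability measures on $\mathbb{R}$. $W_1(\mu,\nu)=\inf_\pi\int_{\mathbb{R}^2}|x-y|\,d\pi(x,y)$, the infimum being over couplings $\pi$ with marginals $\mu,\nu$; $W_1^2$ denotes its square. For continuous $V$ with $\liminf_{|x|\to\infty}V(x)/x^2>0$ and $\mu\in\mathcal{P}(\mathbb{R})$, set $$J_V(\mu)=\int_{\mathbb{R}} V\,d\mu-\iint_{\mathbb{R}^2}\ln|x-y|\,d\mu(x)\,d\mu(y),$$ with the convention $J_V(\mu)=+\infty$ if $\int V\,d\mu=+\infty$. It is a known fact that $c_V=\inf_{\nu\in\mathcal{P}(\mathbb{R})}J_V(\nu)$ is finite and attained at a unique probability measure $\mu_V$, called the equilibrium measure of $V$, which has compact support. The free entropy relative to $V$ is $\Sigma_V(\mu)=J_V(\mu)-c_V=J_V(\mu)-J_V(\mu_V)\in[0,+\infty]$. *)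

theory Defs
  imports "HOL-Probability.Probability"
begin

text \<open>Borel probability measures on the real line are the measures satisfying the library
  predicate \<^const>\<open>real_distribution\<close>.\<close>

definition couplings :: "real measure \<Rightarrow> real measure \<Rightarrow> (real \<times> real) measure set" where
  "couplings \<mu> \<nu> = {\<pi>. sets \<pi> = sets (borel \<Otimes>\<^sub>M borel) \<and>
                      distr \<pi> borel fst = \<mu> \<and> distr \<pi> borel snd = \<nu>}"

definition W1 :: "real measure \<Rightarrow> real measure \<Rightarrow> ennreal" where
  "W1 \<mu> \<nu> = (INF \<pi> \<in> couplings \<mu> \<nu>. \<integral>\<^sup>+ (x, y). ennreal \<bar>x - y\<bar> \<partial>\<pi>)"

text \<open>Integral of an extended real function as the difference of the integrals of its positive
  and negative parts (\<^const>\<open>e2ennreal\<close> sends negative arguments to \<open>0\<close>). It is meaningful when at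
  least one of the two is finite.\<close>

definition ext_integral :: "'a measure \<Rightarrow> ('a \<Rightarrow> ereal) \<Rightarrow> ereal" where
  "ext_integral M f = enn2ereal (\<integral>\<^sup>+ x. e2ennreal (f x) \<partial>M)
                    - enn2ereal (\<integral>\<^sup>+ x. e2ennreal (- f x) \<partial>M)"

text \<open>The value \<open>-\<infinity>\<close> on the diagonal matters: the library has \<open>ln 0 = 0\<close>, which would
  give measures with atoms finite energy.\<close>

definition log_dist :: "real \<Rightarrow> real \<Rightarrow> ereal" where
  "log_dist x y = (if x = y then - \<infinity> else ereal (ln \<bar>x - y\<bar>))"

text \<open>If \<open>V\<close> is continuous and \<open>liminf V(x)/x^2 > 0\<close> as \<open>|x| \<rightarrow> \<infinity>\<close>, then \<open>V\<close> is bounded below, and if \<open>\<integral>V d\<mu>\<close> is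
  finite then the positive part of the logarithmic kernel is integrable, so both integrals are
  meaningful.\<close>

definition J :: "(real \<Rightarrow> real) \<Rightarrow> real measure \<Rightarrow> ereal" where
  "J V \<mu> = (if ext_integral \<mu> (\<lambda>x. ereal (V x)) = \<infinity> then \<infinity>
            else ext_integral \<mu> (\<lambda>x. ereal (V x))
                 - ext_integral (\<mu> \<Otimes>\<^sub>M \<mu>) (\<lambda>(x, y). log_dist x y))"

definition c_min :: "(real \<Rightarrow> real) \<Rightarrow> ereal" where
  "c_min V = (INF \<nu> \<in> {\<nu>. real_distribution \<nu>}. J V \<nu>)"

definition is_equilibrium_measure :: "(real \<Rightarrow> real) \<Rightarrow> real measure \<Rightarrow> bool" where
  "is_equilibrium_measure V \<mu> \<longleftrightarrow> real_distribution \<mu> \<and> J V \<mu> = c_min V"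

definition free_entropy :: "(real \<Rightarrow> real) \<Rightarrow> real measure \<Rightarrow> ereal" where
  "free_entropy V \<mu> = J V \<mu> - c_min V"

end

theory Submission
  imports Defs
begin

text \<open>The distance \<open>W1 \<nu> \<mu>\<close> is at most the \<open>L\<^sup>1\<close> norm of the difference \<open>H\<close> of the distribution functions.
  The identity \<open>- ln u = \<integral> ((r - u)\<^sub>+ - (r - 1)\<^sub>+) / r\<^sup>2 dr\<close> over \<open>r > 0\<close>, together with
  \<open>(r - \<bar>x - y\<bar>)\<^sub>+ = \<integral> 1(z < x \<le> z + r) 1(z < y \<le> z + r) dz\<close>, turns the logarithmic energy of the neutral
  measure \<open>\<nu> - \<mu>\<close> into the \<open>H\<^sup>1\<^sup>/\<^sup>2\<close> seminorm \<open>D = \<integral>\<integral> (H (z + r) - H z)\<^sup>2 / r\<^sup>2 dz dr\<close>.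

  Expanding \<open>J\<close> along the segment from \<open>\<mu>\<close> to \<open>\<nu>\<close> gives \<open>\<Sigma>(\<nu>) = L(\<nu>) + D\<close> with \<open>L\<close> the first variation,
  which is nonnegative because \<open>\<mu>\<close> is a minimizer. Applied to \<open>\<nu>\<close> conditioned on \<open>[-R, R]\<close>, and with the
  quadratic growth of the effective potential outside \<open>[-R, R]\<close>, this yields \<open>L(\<nu>) \<ge> c T\<close>, where
  \<open>T = \<integral> x\<^sup>2 d\<nu>\<close> over \<open>\<bar>x\<bar> > R\<close>; for \<open>\<nu> = \<mu>\<close> it shows that \<open>\<mu>\<close> lives on \<open>[-R, R]\<close>.
  The part of \<open>\<integral> \<bar>H\<bar>\<close> outside \<open>[-R, R]\<close> is at most \<open>T\<close> to the power \<open>1/2\<close>. As \<open>H\<close> is small on \<open>[R, 2 R]\<close>,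
  comparing \<open>H z\<close> with \<open>H (z + r)\<close> there bounds the part inside by \<open>D\<close> and \<open>T\<close>.\<close>

section \<open>Quantile coupling\<close>

text \<open>The two quantile functions, evaluated at the same uniform \<open>u\<close>, form a
  coupling. Their gap at \<open>u\<close> is the length of the set of \<open>x\<close> for which
  \<open>u\<close> lies between the two distribution functions, so exchanging the integrals over
  \<open>u\<close> and \<open>x\<close> bounds the transport cost.\<close>

lemma W1_le_cdf:
  assumes "real_distribution \<nu>" "real_distribution \<mu>"
  shows "W1 \<nu> \<mu> \<le> (\<integral>\<^sup>+x. ennreal \<bar>cdf \<nu> x - cdf \<mu> x\<bar> \<partial>lborel)"
proof -
  interpret N: cdf_distribution \<nu> unfolding cdf_distribution_def by fact
  interpret M: cdf_distribution \<mu> unfolding cdf_distribution_def by fact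
  let ?U = "restrict_space lborel {0<..<1::real} :: real measure"
  define p where "p u = (N.I u, M.I u)" for u :: real
  have sets_U: "sets ?U = sets (restrict_space borel {0<..<1})"
    by (rule sets_restrict_space_cong) simp
  have I[measurable]: "N.I \<in> borel_measurable ?U" "M.I \<in> borel_measurable ?U"
    using N.measurable_CI M.measurable_CI unfolding measurable_cong_sets[OF sets_U refl] by auto
  have p[measurable]: "p \<in> ?U \<rightarrow>\<^sub>M borel \<Otimes>\<^sub>M borel"
    unfolding p_def by (rule measurable_Pair[OF I])
  let ?\<pi> = "distr ?U (borel \<Otimes>\<^sub>M borel) p"
  have "?\<pi> \<in> couplings \<nu> \<mu>"
    unfolding couplings_def
    by (simp add: distr_distr comp_def p_def N.distr_I_eq_M M.distr_I_eq_M)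
  then have "W1 \<nu> \<mu> \<le> (\<integral>\<^sup>+ (x, y). ennreal \<bar>x - y\<bar> \<partial>?\<pi>)"
    unfolding W1_def by (rule INF_lower)
  also have "\<dots> = (\<integral>\<^sup>+u. ennreal \<bar>N.I u - M.I u\<bar> \<partial>?U)"
    by (subst nn_integral_distr) (auto simp: p_def)
  also have "\<dots> = (\<integral>\<^sup>+u. ennreal \<bar>N.I u - M.I u\<bar> * indicator {0<..<1} u \<partial>lborel)"
    by (subst nn_integral_restrict_space) auto
  also have "\<dots> = (\<integral>\<^sup>+u. (\<integral>\<^sup>+x. indicator {0<..<1} u *
      indicator {v. (v \<le> cdf \<nu> x) \<noteq> (v \<le> cdf \<mu> x)} u \<partial>lborel) \<partial>lborel)"
  proof (rule nn_integral_cong)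
    fix u :: real
    show "ennreal \<bar>N.I u - M.I u\<bar> * indicator {0<..<1} u = (\<integral>\<^sup>+x. indicator {0<..<1} u *
      indicator {v. (v \<le> cdf \<nu> x) \<noteq> (v \<le> cdf \<mu> x)} u \<partial>lborel)"
    proof (cases "u \<in> {0<..<1}")
      case True
      \<comment> \<open>The quantile function is a lower adjoint: \<open>N.I u \<le> x\<close> iff
        \<open>u \<le> cdf \<nu> x\<close>. This is why the interval contains its left endpoint and
        not its right one.\<close>
      have "indicator {v. (v \<le> cdf \<nu> x) \<noteq> (v \<le> cdf \<mu> x)} u =
          (indicator {min (N.I u) (M.I u)..<max (N.I u) (M.I u)} x :: ennreal)" for x
        using N.pseudoinverse'[rule_format, OF True, of x] M.pseudoinverse'[rule_format, OF True, of x]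
        by (auto simp: indicator_def min_def max_def)
      then have "(\<integral>\<^sup>+x. indicator {0<..<1} u *
          indicator {v. (v \<le> cdf \<nu> x) \<noteq> (v \<le> cdf \<mu> x)} u \<partial>lborel)
        = (\<integral>\<^sup>+x. indicator {min (N.I u) (M.I u)..<max (N.I u) (M.I u)} x \<partial>lborel)"
        using True by simp
      also have "\<dots> = ennreal \<bar>N.I u - M.I u\<bar>"
        by (subst nn_integral_indicator) (auto simp: min_def max_def abs_if)
      finally show ?thesis using True by simp
    qed auto
  qed
  also have "\<dots> = (\<integral>\<^sup>+x. (\<integral>\<^sup>+u. indicator {0<..<1} u *
      indicator {v. (v \<le> cdf \<nu> x) \<noteq> (v \<le> cdf \<mu> x)} u \<partial>lborel) \<partial>lborel)"
    by (rule lborel_pair.Fubini') (simp add: indicator_def[abs_def] split_beta')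
  also have "\<dots> \<le> (\<integral>\<^sup>+x. (\<integral>\<^sup>+u. 
      indicator {min (cdf \<nu> x) (cdf \<mu> x)<..max (cdf \<nu> x) (cdf \<mu> x)} u \<partial>lborel) \<partial>lborel)"
    by (intro nn_integral_mono) (auto simp: indicator_def min_def max_def)
  also have "\<dots> = (\<integral>\<^sup>+x. ennreal \<bar>cdf \<nu> x - cdf \<mu> x\<bar> \<partial>lborel)"
    by (intro nn_integral_cong, subst nn_integral_indicator) (auto simp: min_def max_def abs_if)
  finally show ?thesis .
qed

section \<open>The truncated logarithmic kernel\<close>

text \<open>The kernel \<open>- ln u\<close> changes sign. Dropping the compensating term of its
  integral representation and cutting off at \<open>r < A\<close> leaves a nonnegative integrand, to
  which Tonelli applies freely. For \<open>0 < u\<close> the error against \<open>- ln u\<close>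
  tends to the constant \<open>ln A - 1\<close> as \<open>A\<close> grows. Values in
  \<open>ennreal\<close> allow \<open>\<infinity>\<close> at \<open>u = 0\<close>.\<close>

definition kern :: "real \<Rightarrow> real \<Rightarrow> ennreal" where
  "kern A u = (\<integral>\<^sup>+r. ennreal (indicator {0<..<A} r * (max 0 (r - u) / r\<^sup>2)) \<partial>lborel)"

text \<open>Real closed form of \<open>kern\<close> for \<open>0 < u\<close>. At
  \<open>u = 0\<close> its value comes from \<open>ln 0 = 0\<close> and differs from that of
  \<open>kern\<close>.\<close>

definition rkern :: "real \<Rightarrow> real \<Rightarrow> real" where
  "rkern A u = (if u < A then ln A - ln u - 1 + u / A else 0)"

lemma kern_eq_rkern:
  assumes "0 < u" "0 < A"
  shows "kern A u = ennreal (rkern A u)"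
proof (cases "u < A")
  case True
  \<comment> \<open>The fundamental theorem of calculus is applied on a closed interval, so the
    endpoint \<open>A\<close> is added; a single point is a null set.\<close>
  have "kern A u = (\<integral>\<^sup>+r. ennreal (max 0 (r - u) / r\<^sup>2) * indicator {u..A} r \<partial>lborel)"
    unfolding kern_def
  proof (rule nn_integral_cong_AE, rule AE_mp[OF AE_lborel_singleton[of A]], rule AE_I2, rule impI)
    fix r assume "r \<noteq> A"
    then show "ennreal (indicator {0<..<A} r * (max 0 (r - u) / r\<^sup>2)) =
        ennreal (max 0 (r - u) / r\<^sup>2) * indicator {u..A} r"
      using assms by (cases "r \<le> u"; cases "r < A") (simp_all add: indicator_def)
  qed
  also have "\<dots> = ennreal ((ln A + u / A) - (ln u + u / u))"
  proof (rule nn_integral_FTC_Icc[where F="\<lambda>r. ln r + u / r"])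
    fix r assume r: "r \<in> {u..A}"
    then have r0: "0 < r" using assms by auto
    have "((\<lambda>r. ln r + u / r) has_real_derivative 1 / r + (0 * r - u * 1) / (r * r)) (at r)"
      using r0 by (intro DERIV_add DERIV_divide DERIV_const DERIV_ident DERIV_ln_divide) auto
    moreover have "1 / r + (0 * r - u * 1) / (r * r) = max 0 (r - u) / r\<^sup>2"
      using r r0 by (simp add: field_simps power2_eq_square)
    ultimately show "((\<lambda>r. ln r + u / r) has_real_derivative max 0 (r - u) / r\<^sup>2) (at r)"
      by simp
  qed (use True in auto)
  finally show ?thesis using True assms by (simp add: rkern_def algebra_simps)
next
  case False
  then have "kern A u = (\<integral>\<^sup>+r. 0 \<partial>(lborel :: real measure))"
    unfolding kern_def by (intro nn_integral_cong) (simp add: indicator_def)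
  then show ?thesis using False by (simp add: rkern_def)
qed

lemma kern_antimono: "u \<le> v \<Longrightarrow> kern A v \<le> kern A u"
  unfolding kern_def
  by (intro nn_integral_mono ennreal_leI mult_left_mono divide_right_mono) auto

text \<open>By monotonicity \<open>kern A 0\<close> exceeds every \<open>rkern A u\<close>, and
  these are unbounded as \<open>u\<close> tends to 0. This is how finite energy excludes mass on the
  diagonal.\<close>

lemma kern_0: "0 < A \<Longrightarrow> kern A 0 = \<infinity>"
proof (rule ccontr)
  assume A: "0 < A" and fin: "kern A 0 \<noteq> \<infinity>"
  then obtain K where K: "0 \<le> K" "kern A 0 = ennreal K" by (cases "kern A 0") auto
  \<comment> \<open>Chosen so that \<open>ln A - ln u - 1 = K + 1\<close>, which is already above
    \<open>K\<close>.\<close>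
  define u where "u = A * exp (- K - 2)"
  have u: "0 < u" "u < A" using A K by (auto simp: u_def)
  have "ennreal (rkern A u) \<le> ennreal K"
    using kern_antimono[of 0 u A] kern_eq_rkern[of u A] u A K by simp
  moreover have "rkern A u > K"
    using u A by (simp add: rkern_def u_def ln_mult add_pos_pos)
  ultimately show False using K by (simp add: ennreal_le_iff2)
qed

lemma rkern_nonneg:
  assumes "0 < u" "0 < A"
  shows "0 \<le> rkern A u"
proof (cases "u < A")
  case True
  have "ln (u / A) \<le> u / A - 1" using assms by (intro ln_le_minus_one) auto
  with True assms show ?thesis by (simp add: rkern_def ln_div)
qed (simp add: rkern_def)

text \<open>Splits the logarithm for integrability: the energy controls the singularity at 0, the
  first moment controls the growth at infinity.\<close>

lemma abs_ln_le_rkern: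
  assumes "0 < u"
  shows "\<bar>ln u\<bar> \<le> rkern 1 u + 1 + u"
proof (cases "u < 1")
  case True
  then show ?thesis using assms by (simp add: rkern_def)
next
  case False
  then show ?thesis using ln_le_minus_one[of u] by (simp add: rkern_def)
qed

text \<open>The bound is independent of \<open>A\<close> and serves as the dominating function when
  \<open>A\<close> tends to infinity.\<close>

lemma rkern_minus_ln_bound:
  assumes "0 < u" "1 \<le> A"
  shows "\<bar>rkern A u - ln A + 1\<bar> \<le> \<bar>ln u\<bar> + 1"
proof (cases "u < A")
  case True
  then have "0 \<le> u / A" "u / A \<le> 1" using assms by auto
  then show ?thesis using True by (simp add: rkern_def)
next
  case False
  then have "ln A \<le> ln u" "0 \<le> ln A" using assms by auto
  with False show ?thesis by (simp add: rkern_def)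
qed

lemma tendsto_rkern_minus_ln:
  assumes "0 < u"
  shows "(\<lambda>n. rkern (real (Suc n)) u - ln (real (Suc n)) + 1) \<longlonglongrightarrow> - ln u"
proof -
  have "(\<lambda>n. - ln u + u * inverse (real (Suc n))) \<longlonglongrightarrow> - ln u + u * 0"
    by (intro tendsto_intros LIMSEQ_inverse_real_of_nat)
  moreover have "\<forall>\<^sub>F n in sequentially. real (Suc n) > u"
    using eventually_gt_at_top[of "nat \<lceil>u\<rceil>"] by eventually_elim linarith
  then have "\<forall>\<^sub>F n in sequentially. - ln u + u * inverse (real (Suc n))
      = rkern (real (Suc n)) u - ln (real (Suc n)) + 1"
    by eventually_elim (simp add: rkern_def field_simps)
  ultimately show ?thesis by (simp add: tendsto_cong)
qed

lemma borel_measurable_kern[measurable]: "kern A \<in> borel_measurable borel"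
  unfolding kern_def by measurable

lemma borel_measurable_rkern[measurable]: "rkern A \<in> borel_measurable borel"
  unfolding rkern_def by measurable

section \<open>Truncated energy as an integral over windows \<open>{z<..z + r}\<close>\<close>

definition energy :: "real \<Rightarrow> real measure \<Rightarrow> real measure \<Rightarrow> ennreal" where
  "energy A \<nu> \<mu> = (\<integral>\<^sup>+x. (\<integral>\<^sup>+y. kern A \<bar>x - y\<bar> \<partial>\<mu>) \<partial>\<nu>)"

text \<open>For \<open>0 \<le> r\<close> this is the mass that \<nu> gives to the window
  \<open>{z<..z + r}\<close>.\<close>

definition incr :: "real measure \<Rightarrow> real \<Rightarrow> real \<Rightarrow> real" where
  "incr \<nu> r z = cdf \<nu> (z + r) - cdf \<nu> z"

lemma borel_measurable_cdf:
  assumes "real_distribution \<nu>"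
  shows "cdf \<nu> \<in> borel_measurable borel"
  using assms cdf_distribution.measurable_C unfolding cdf_distribution_def by blast

lemma borel_measurable_incr:
  assumes "real_distribution \<nu>"
  shows "(\<lambda>(r, z). incr \<nu> r z) \<in> borel_measurable (borel \<Otimes>\<^sub>M borel)"
proof -
  note borel_measurable_cdf[OF assms, measurable]
  show ?thesis unfolding incr_def by measurable
qed

lemma incr_nonneg:
  assumes "real_distribution \<nu>" "0 \<le> r"
  shows "0 \<le> incr \<nu> r z"
proof -
  interpret real_distribution \<nu> by fact
  show ?thesis using assms by (simp add: incr_def cdf_nondecreasing)
qed

text \<open>Both points lie in the window exactly when \<open>max x y - r \<le> z < min x y\<close>,
  an interval of length \<open>r - \<bar>x - y\<bar>\<close>, or empty if that is negative.\<close>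

lemma nn_integral_indicator_Ioc_Ioc:
  "(\<integral>\<^sup>+z. indicator {z<..z + r} x * indicator {z<..z + r} y \<partial>lborel) = ennreal (max 0 (r - \<bar>x - y\<bar>))"
  for x y r :: real
proof -
  have "(\<integral>\<^sup>+z. indicator {z<..z + r} x * indicator {z<..z + r} y \<partial>lborel)
      = (\<integral>\<^sup>+z. indicator {max x y - r..<min x y} z \<partial>lborel)"
    by (intro nn_integral_cong) (auto simp: indicator_def)
  also have "\<dots> = ennreal (max 0 (r - \<bar>x - y\<bar>))"
    by (cases "max x y - r \<le> min x y") (auto simp: max_def min_def abs_if split: if_splits)
  finally show ?thesis .
qed

text \<open>Separates the variables: for a fixed window, \<open>x\<close> and \<open>y\<close> occur
  in different factors, so integrating against two measures will give a product of window
  masses.\<close>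

lemma kern_eq_pair:
  "kern A \<bar>x - y\<bar> = (\<integral>\<^sup>+(r, z). ennreal (indicator {0<..<A} r / r\<^sup>2) *
     (indicator {z<..z + r} x * indicator {z<..z + r} y) \<partial>(lborel \<Otimes>\<^sub>M lborel))"
proof -
  have "(\<integral>\<^sup>+(r, z). ennreal (indicator {0<..<A} r / r\<^sup>2) *
     (indicator {z<..z + r} x * indicator {z<..z + r} y) \<partial>(lborel \<Otimes>\<^sub>M lborel))
     = (\<integral>\<^sup>+r. (\<integral>\<^sup>+z. ennreal (indicator {0<..<A} r / r\<^sup>2) *
     (indicator {z<..z + r} x * indicator {z<..z + r} y) \<partial>lborel) \<partial>lborel)"
    by (subst lborel.nn_integral_fst[symmetric]) (simp_all add: indicator_def[abs_def] split_beta')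
  also have "\<dots> = (\<integral>\<^sup>+r. ennreal (indicator {0<..<A} r / r\<^sup>2) * ennreal (max 0 (r - \<bar>x - y\<bar>)) \<partial>lborel)"
    unfolding nn_integral_indicator_Ioc_Ioc[symmetric]
    by (intro nn_integral_cong nn_integral_cmult) (simp add: indicator_def[abs_def])
  also have "\<dots> = kern A \<bar>x - y\<bar>"
    unfolding kern_def
    by (intro nn_integral_cong, subst ennreal_mult[symmetric]) (simp_all)
  finally show ?thesis ..
qed

text \<open>Tonelli twice on \<open>kern_eq_pair\<close>: first the integral over \<open>y\<close>,
  then the one over \<open>x\<close>, is moved inside the integral over windows.\<close>

lemma energy_eq_pair:
  assumes \<nu>: "real_distribution \<nu>" and \<mu>: "real_distribution \<mu>"
  shows "energy A \<nu> \<mu> = (\<integral>\<^sup>+(r, z). ennreal (indicator {0<..<A} r / r\<^sup>2 * (incr \<nu> r z * incr \<mu> r z)) \<partial>(lborel \<Otimes>\<^sub>M lborel))"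
proof -
  interpret N: real_distribution \<nu> by fact
  interpret M: real_distribution \<mu> by fact
  interpret W: sigma_finite_measure "lborel \<Otimes>\<^sub>M lborel :: (real \<times> real) measure"
    by (simp add: lborel_prod sigma_finite_lborel)
  interpret MW: pair_sigma_finite \<mu> "lborel \<Otimes>\<^sub>M lborel :: (real \<times> real) measure" ..
  interpret NW: pair_sigma_finite \<nu> "lborel \<Otimes>\<^sub>M lborel :: (real \<times> real) measure" ..
  have [measurable_cong]: "sets \<nu> = sets borel" "sets \<mu> = sets borel" by simp_all
  define c where "c p = ennreal (indicator {0<..<A} (fst p) / (fst p)\<^sup>2)" for p :: "real \<times> real"
  define i where "i p x = (indicator {snd p<..snd p + fst p} x :: ennreal)" for p and x :: real
  have [measurable]: "c \<in> borel_measurable (lborel \<Otimes>\<^sub>M lborel)"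
    unfolding c_def by measurable
  have mi[measurable]: "(\<lambda>(x, p). i p x) \<in> borel_measurable (borel \<Otimes>\<^sub>M (lborel \<Otimes>\<^sub>M lborel))"
    unfolding i_def by (simp add: indicator_def[abs_def] split_beta')
  have ii: "(\<integral>\<^sup>+x. i p x \<partial>\<rho>) = emeasure \<rho> {snd p<..snd p + fst p}" if "sets \<rho> = sets borel" for p \<rho>
    unfolding i_def using that by (subst nn_integral_indicator) auto
  have "energy A \<nu> \<mu> = (\<integral>\<^sup>+x. (\<integral>\<^sup>+y. (\<integral>\<^sup>+p. c p * (i p x * i p y) \<partial>(lborel \<Otimes>\<^sub>M lborel)) \<partial>\<mu>) \<partial>\<nu>)"
    unfolding energy_def kern_eq_pair by (simp add: c_def i_def split_beta')
  also have "\<dots> = (\<integral>\<^sup>+x. (\<integral>\<^sup>+p. (\<integral>\<^sup>+y. c p * (i p x * i p y) \<partial>\<mu>) \<partial>(lborel \<Otimes>\<^sub>M lborel)) \<partial>\<nu>)"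
    by (intro nn_integral_cong MW.Fubini'[symmetric]) measurable
  also have "\<dots> = (\<integral>\<^sup>+x. (\<integral>\<^sup>+p. c p * i p x * emeasure \<mu> {snd p<..snd p + fst p} \<partial>(lborel \<Otimes>\<^sub>M lborel)) \<partial>\<nu>)"
    by (intro nn_integral_cong) (simp add: mult.assoc[symmetric] nn_integral_cmult ii)
  also have "\<dots> = (\<integral>\<^sup>+x. (\<integral>\<^sup>+p. c p * emeasure \<mu> {snd p<..snd p + fst p} * i p x \<partial>(lborel \<Otimes>\<^sub>M lborel)) \<partial>\<nu>)"
    by (simp add: ac_simps)
  also have "\<dots> = (\<integral>\<^sup>+p. (\<integral>\<^sup>+x. c p * emeasure \<mu> {snd p<..snd p + fst p} * i p x \<partial>\<nu>) \<partial>(lborel \<Otimes>\<^sub>M lborel))"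
  proof (rule NW.Fubini'[symmetric])
    have [measurable]: "(\<lambda>p. emeasure \<mu> {snd p<..snd p + fst p}) \<in> borel_measurable (lborel \<Otimes>\<^sub>M lborel)"
      unfolding ii[OF M.events_eq_borel, symmetric] by measurable
    show "(\<lambda>(x, p). c p * emeasure \<mu> {snd p<..snd p + fst p} * i p x) \<in> borel_measurable (\<nu> \<Otimes>\<^sub>M (lborel \<Otimes>\<^sub>M lborel))"
      by measurable
  qed
  also have "\<dots> = (\<integral>\<^sup>+p. c p * emeasure \<mu> {snd p<..snd p + fst p} * emeasure \<nu> {snd p<..snd p + fst p} \<partial>(lborel \<Otimes>\<^sub>M lborel))"
    by (intro nn_integral_cong) (simp add: nn_integral_cmult ii)
  also have "\<dots> = (\<integral>\<^sup>+(r, z). ennreal (indicator {0<..<A} r / r\<^sup>2 * (incr \<nu> r z * incr \<mu> r z)) \<partial>(lborel \<Otimes>\<^sub>M lborel))"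
  proof (intro nn_integral_cong, clarsimp)
    fix r z :: real
    show "c (r, z) * emeasure \<mu> {z<..z + r} * emeasure \<nu> {z<..z + r}
      = ennreal (indicator {0<..<A} r * (incr \<nu> r z * incr \<mu> r z) / r\<^sup>2)"
    proof (cases "r \<in> {0<..<A}")
      case True
      then show ?thesis
        using incr_nonneg[OF \<nu>, of r z] incr_nonneg[OF \<mu>, of r z]
        by (simp add: c_def N.emeasure_Ioc M.emeasure_Ioc ennreal_mult[symmetric] incr_def[symmetric])
    qed (simp add: c_def)
  qed
  finally show ?thesis .
qed

text \<open>In the window representation this is the pointwise bound of a product by the sum of the
  squares. It makes mutual energies finite as soon as self-energies are.\<close>

lemma energy_cross_le:
  assumes \<nu>: "real_distribution \<nu>" and \<mu>: "real_distribution \<mu>"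
  shows "energy A \<nu> \<mu> \<le> energy A \<nu> \<nu> + energy A \<mu> \<mu>"
proof -
  note borel_measurable_incr[OF \<nu>, measurable] borel_measurable_incr[OF \<mu>, measurable]
  have "energy A \<nu> \<mu> \<le> (\<integral>\<^sup>+(r, z). (ennreal (indicator {0<..<A} r / r\<^sup>2 * (incr \<nu> r z * incr \<nu> r z))
      + ennreal (indicator {0<..<A} r / r\<^sup>2 * (incr \<mu> r z * incr \<mu> r z))) \<partial>(lborel \<Otimes>\<^sub>M lborel))"
    unfolding energy_eq_pair[OF \<nu> \<mu>]
  proof (intro nn_integral_mono, clarsimp simp only: split_paired_all prod.case)
    fix r z :: real
    have "incr \<nu> r z * incr \<mu> r z \<le> incr \<nu> r z * incr \<nu> r z + incr \<mu> r z * incr \<mu> r z"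
      using zero_le_square[of "incr \<nu> r z + incr \<mu> r z"] zero_le_square[of "incr \<nu> r z - incr \<mu> r z"]
      by (simp add: algebra_simps)
    then have "indicator {0<..<A} r / r\<^sup>2 * (incr \<nu> r z * incr \<mu> r z)
      \<le> indicator {0<..<A} r / r\<^sup>2 * (incr \<nu> r z * incr \<nu> r z) + indicator {0<..<A} r / r\<^sup>2 * (incr \<mu> r z * incr \<mu> r z)"
      unfolding distrib_left[symmetric] by (rule mult_left_mono) simp
    then show "ennreal (indicator {0<..<A} r / r\<^sup>2 * (incr \<nu> r z * incr \<mu> r z))
      \<le> ennreal (indicator {0<..<A} r / r\<^sup>2 * (incr \<nu> r z * incr \<nu> r z))
       + ennreal (indicator {0<..<A} r / r\<^sup>2 * (incr \<mu> r z * incr \<mu> r z))"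
      by (subst ennreal_plus[symmetric]) (simp, simp, rule ennreal_leI)
  qed
  also have "\<dots> = energy A \<nu> \<nu> + energy A \<mu> \<mu>"
    unfolding energy_eq_pair[OF \<nu> \<nu>] energy_eq_pair[OF \<mu> \<mu>]
    by (subst nn_integral_add[symmetric]) (auto simp: split_beta')
  finally show ?thesis .
qed

section \<open>Measures of finite logarithmic energy\<close>

text \<open>The first moment takes care of the logarithm at large distances and the energy at
  truncation 1 of its singularity at small ones. Together they make
  \<open>ln \<bar>x - y\<bar>\<close> integrable for products of such measures.\<close>

definition log_finite :: "real measure \<Rightarrow> bool" where
  "log_finite \<nu> \<longleftrightarrow> real_distribution \<nu> \<and> integrable \<nu> (\<lambda>x. x) \<and> energy 1 \<nu> \<nu> < \<infinity>"

(* The junk value ln 0 = 0 is harmless: kern_0 makes the diagonal a null set when log_finite holds. *)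
definition log_energy :: "real measure \<Rightarrow> real measure \<Rightarrow> real" where
  "log_energy \<nu> \<mu> = (\<integral>p. ln \<bar>fst p - snd p\<bar> \<partial>(\<nu> \<Otimes>\<^sub>M \<mu>))"

lemma integrable_fst_snd_pair:
  assumes "real_distribution \<nu>" "real_distribution \<mu>"
    and f: "integrable \<nu> f" and g: "integrable \<mu> g"
  shows "integrable (\<nu> \<Otimes>\<^sub>M \<mu>) (\<lambda>p. f (fst p) :: real)" "integrable (\<nu> \<Otimes>\<^sub>M \<mu>) (\<lambda>p. g (snd p) :: real)"
proof -
  interpret N: real_distribution \<nu> by fact
  interpret M: real_distribution \<mu> by fact
  interpret MN: pair_sigma_finite \<mu> \<nu> ..
  show "integrable (\<nu> \<Otimes>\<^sub>M \<mu>) (\<lambda>p. f (fst p))"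
    using f by (intro integrable_distr[of fst _ \<nu>]) (simp_all add: M.distr_pair_fst)
  have "integrable (\<mu> \<Otimes>\<^sub>M \<nu>) (\<lambda>p. g (fst p))"
    using g by (intro integrable_distr[of fst _ \<mu>]) (simp_all add: N.distr_pair_fst)
  then show "integrable (\<nu> \<Otimes>\<^sub>M \<mu>) (\<lambda>p. g (snd p))"
    using MN.integrable_product_swap[of "\<lambda>p. g (fst p)"] by (simp add: split_beta')
qed

lemma energy_eq_pair_kern:
  assumes "real_distribution \<nu>" "real_distribution \<mu>"
  shows "energy A \<nu> \<mu> = (\<integral>\<^sup>+p. kern A \<bar>fst p - snd p\<bar> \<partial>(\<nu> \<Otimes>\<^sub>M \<mu>))"
proof -
  interpret N: real_distribution \<nu> by fact
  interpret M: real_distribution \<mu> by fact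
  have [measurable_cong]: "sets \<nu> = sets borel" "sets \<mu> = sets borel" by simp_all
  show ?thesis unfolding energy_def by (subst M.nn_integral_fst[symmetric]) auto
qed

context
  fixes \<nu> \<mu> assumes \<nu>: "log_finite \<nu>" and \<mu>: "log_finite \<mu>"
begin

lemma real_distributions: "real_distribution \<nu>" "real_distribution \<mu>"
  using \<nu> \<mu> by (auto simp: log_finite_def)

lemma energy_finite: "energy 1 \<nu> \<mu> < \<infinity>"
  using energy_cross_le[OF real_distributions, of 1] \<nu> \<mu>
  by (auto simp: log_finite_def order_le_less_trans)

text \<open>A function of finite integral is finite almost everywhere, while by
  \<open>kern_0\<close> the kernel is infinite on the diagonal.\<close>

lemma AE_pair_neq: "AE p in \<nu> \<Otimes>\<^sub>M \<mu>. fst p \<noteq> snd p"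
proof -
  interpret N: real_distribution \<nu> by (fact real_distributions)
  interpret M: real_distribution \<mu> by (fact real_distributions)
  have [measurable_cong]: "sets \<nu> = sets borel" "sets \<mu> = sets borel" by simp_all
  have "AE p in \<nu> \<Otimes>\<^sub>M \<mu>. kern 1 \<bar>fst p - snd p\<bar> \<noteq> \<infinity>"
    using energy_finite energy_eq_pair_kern[OF real_distributions, of 1]
    by (intro nn_integral_PInf_AE) auto
  then show ?thesis by eventually_elim (auto simp: kern_0)
qed

lemma measurable_pair_diff:
  assumes "f \<in> borel_measurable borel"
  shows "(\<lambda>p. f \<bar>fst p - snd p\<bar>) \<in> borel_measurable (\<nu> \<Otimes>\<^sub>M \<mu>)"
proof -
  interpret N: real_distribution \<nu> by (fact real_distributions)
  interpret M: real_distribution \<mu> by (fact real_distributions)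
  have [measurable_cong]: "sets \<nu> = sets borel" "sets \<mu> = sets borel" by simp_all
  note assms[measurable]
  show ?thesis by measurable
qed

lemma integrable_ln_pair: "integrable (\<nu> \<Otimes>\<^sub>M \<mu>) (\<lambda>p. ln \<bar>fst p - snd p\<bar>)"
proof -
  interpret N: real_distribution \<nu> by (fact real_distributions)
  interpret M: real_distribution \<mu> by (fact real_distributions)
  interpret P: pair_prob_space \<nu> \<mu> ..
  have k: "integrable (\<nu> \<Otimes>\<^sub>M \<mu>) (\<lambda>p. enn2real (kern 1 \<bar>fst p - snd p\<bar>))"
  proof (rule integrableI_bounded)
    show "(\<lambda>p. enn2real (kern 1 \<bar>fst p - snd p\<bar>)) \<in> borel_measurable (\<nu> \<Otimes>\<^sub>M \<mu>)"
      by (rule measurable_pair_diff) measurable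
    have "(\<integral>\<^sup>+p. ennreal (norm (enn2real (kern 1 \<bar>fst p - snd p\<bar>))) \<partial>(\<nu> \<Otimes>\<^sub>M \<mu>)) \<le> energy 1 \<nu> \<mu>"
      unfolding energy_eq_pair_kern[OF real_distributions]
      by (intro nn_integral_mono) (simp add: ennreal_enn2real_if)
    then show "(\<integral>\<^sup>+p. ennreal (norm (enn2real (kern 1 \<bar>fst p - snd p\<bar>))) \<partial>(\<nu> \<Otimes>\<^sub>M \<mu>)) < \<infinity>"
      using energy_finite by (rule order_le_less_trans)
  qed
  have xy: "integrable (\<nu> \<Otimes>\<^sub>M \<mu>) (\<lambda>p. \<bar>fst p\<bar>)" "integrable (\<nu> \<Otimes>\<^sub>M \<mu>) (\<lambda>p. \<bar>snd p\<bar>)"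
    using integrable_fst_snd_pair[OF real_distributions, of abs abs] \<nu> \<mu> by (auto simp: log_finite_def)
  show ?thesis
  proof (rule Bochner_Integration.integrable_bound)
    show "integrable (\<nu> \<Otimes>\<^sub>M \<mu>) (\<lambda>p. enn2real (kern 1 \<bar>fst p - snd p\<bar>) + 1 + (\<bar>fst p\<bar> + \<bar>snd p\<bar>))"
      using k xy by simp
    show "(\<lambda>p. ln \<bar>fst p - snd p\<bar>) \<in> borel_measurable (\<nu> \<Otimes>\<^sub>M \<mu>)"
      by (rule measurable_pair_diff) measurable
    show "AE p in \<nu> \<Otimes>\<^sub>M \<mu>. norm (ln \<bar>fst p - snd p\<bar>)
        \<le> norm (enn2real (kern 1 \<bar>fst p - snd p\<bar>) + 1 + (\<bar>fst p\<bar> + \<bar>snd p\<bar>))"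
      using AE_pair_neq
    proof eventually_elim
      case (elim p)
      then have "0 < \<bar>fst p - snd p\<bar>" by simp
      from abs_ln_le_rkern[OF this] kern_eq_rkern[OF this, of 1] rkern_nonneg[OF this, of 1]
      show ?case using abs_triangle_ineq4[of "fst p" "snd p"] by simp
    qed
  qed
qed

lemma integrable_rkern_pair:
  assumes "1 \<le> A"
  shows "integrable (\<nu> \<Otimes>\<^sub>M \<mu>) (\<lambda>p. rkern A \<bar>fst p - snd p\<bar> - ln A + 1)" (is ?int)
    and "integrable (\<nu> \<Otimes>\<^sub>M \<mu>) (\<lambda>p. rkern A \<bar>fst p - snd p\<bar>)"
    and "(\<integral>p. rkern A \<bar>fst p - snd p\<bar> - ln A + 1 \<partial>(\<nu> \<Otimes>\<^sub>M \<mu>)) = (\<integral>p. rkern A \<bar>fst p - snd p\<bar> \<partial>(\<nu> \<Otimes>\<^sub>M \<mu>)) - ln A + 1"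
proof -
  interpret N: real_distribution \<nu> by (fact real_distributions)
  interpret M: real_distribution \<mu> by (fact real_distributions)
  interpret P: pair_prob_space \<nu> \<mu> ..
  show int: ?int
  proof (rule Bochner_Integration.integrable_bound)
    show "integrable (\<nu> \<Otimes>\<^sub>M \<mu>) (\<lambda>p. \<bar>ln \<bar>fst p - snd p\<bar>\<bar> + 1)"
      using integrable_ln_pair by simp
    show "(\<lambda>p. rkern A \<bar>fst p - snd p\<bar> - ln A + 1) \<in> borel_measurable (\<nu> \<Otimes>\<^sub>M \<mu>)"
      by (rule measurable_pair_diff) measurable
    show "AE p in \<nu> \<Otimes>\<^sub>M \<mu>. norm (rkern A \<bar>fst p - snd p\<bar> - ln A + 1) \<le> norm (\<bar>ln \<bar>fst p - snd p\<bar>\<bar> + 1)"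
      using AE_pair_neq by eventually_elim (use rkern_minus_ln_bound[of "\<bar>_\<bar>"] assms in simp)
  qed
  have "integrable (\<nu> \<Otimes>\<^sub>M \<mu>) (\<lambda>p. (rkern A \<bar>fst p - snd p\<bar> - ln A + 1) + (ln A - 1))"
    by (intro Bochner_Integration.integrable_add int) simp
  then show i: "integrable (\<nu> \<Otimes>\<^sub>M \<mu>) (\<lambda>p. rkern A \<bar>fst p - snd p\<bar>)" by simp
  show "(\<integral>p. rkern A \<bar>fst p - snd p\<bar> - ln A + 1 \<partial>(\<nu> \<Otimes>\<^sub>M \<mu>)) = (\<integral>p. rkern A \<bar>fst p - snd p\<bar> \<partial>(\<nu> \<Otimes>\<^sub>M \<mu>)) - ln A + 1"
    using i by (simp add: P.prob_space)
qed

text \<open>Dominated convergence. The truncation levels are \<open>Suc n\<close> because the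
  dominating bound requires them to be at least 1.\<close>

lemma tendsto_integral_rkern:
  "(\<lambda>n. (\<integral>p. rkern (real (Suc n)) \<bar>fst p - snd p\<bar> \<partial>(\<nu> \<Otimes>\<^sub>M \<mu>)) - ln (real (Suc n)) + 1)
     \<longlonglongrightarrow> - log_energy \<nu> \<mu>"
proof -
  have "(\<lambda>n. \<integral>p. rkern (real (Suc n)) \<bar>fst p - snd p\<bar> - ln (real (Suc n)) + 1 \<partial>(\<nu> \<Otimes>\<^sub>M \<mu>))
     \<longlonglongrightarrow> (\<integral>p. - ln \<bar>fst p - snd p\<bar> \<partial>(\<nu> \<Otimes>\<^sub>M \<mu>))"
  proof (rule integral_dominated_convergence)
    interpret N: real_distribution \<nu> by (fact real_distributions)
    interpret M: real_distribution \<mu> by (fact real_distributions)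
    interpret P: pair_prob_space \<nu> \<mu> ..
    show "integrable (\<nu> \<Otimes>\<^sub>M \<mu>) (\<lambda>p. \<bar>ln \<bar>fst p - snd p\<bar>\<bar> + 1)"
      using integrable_ln_pair by simp
    show "(\<lambda>p. - ln \<bar>fst p - snd p\<bar>) \<in> borel_measurable (\<nu> \<Otimes>\<^sub>M \<mu>)"
      by (rule measurable_pair_diff) measurable
    fix n
    show "(\<lambda>p. rkern (real (Suc n)) \<bar>fst p - snd p\<bar> - ln (real (Suc n)) + 1) \<in> borel_measurable (\<nu> \<Otimes>\<^sub>M \<mu>)"
      by (rule measurable_pair_diff) measurable
    show "AE p in \<nu> \<Otimes>\<^sub>M \<mu>. norm (rkern (real (Suc n)) \<bar>fst p - snd p\<bar> - ln (real (Suc n)) + 1) \<le> \<bar>ln \<bar>fst p - snd p\<bar>\<bar> + 1"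
      using AE_pair_neq
    proof eventually_elim
      case (elim p)
      then show ?case using rkern_minus_ln_bound[of "\<bar>fst p - snd p\<bar>" "real (Suc n)"] by simp
    qed
  next
    show "AE p in \<nu> \<Otimes>\<^sub>M \<mu>. (\<lambda>n. rkern (real (Suc n)) \<bar>fst p - snd p\<bar> - ln (real (Suc n)) + 1)
        \<longlonglongrightarrow> - ln \<bar>fst p - snd p\<bar>"
      using AE_pair_neq by eventually_elim (rule tendsto_rkern_minus_ln, simp)
  qed
  then show ?thesis by (simp add: integrable_rkern_pair log_energy_def)
qed

lemma energy_eq_integral_rkern:
  assumes "1 \<le> A"
  shows "energy A \<nu> \<mu> = ennreal (\<integral>p. rkern A \<bar>fst p - snd p\<bar> \<partial>(\<nu> \<Otimes>\<^sub>M \<mu>))"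
proof -
  have pos: "AE p in \<nu> \<Otimes>\<^sub>M \<mu>. 0 \<le> rkern A \<bar>fst p - snd p\<bar>"
    using AE_pair_neq by eventually_elim (use assms in \<open>auto intro: rkern_nonneg\<close>)
  have "energy A \<nu> \<mu> = (\<integral>\<^sup>+p. ennreal (rkern A \<bar>fst p - snd p\<bar>) \<partial>(\<nu> \<Otimes>\<^sub>M \<mu>))"
    unfolding energy_eq_pair_kern[OF real_distributions]
    by (rule nn_integral_cong_AE, use AE_pair_neq in eventually_elim)
       (use assms in \<open>auto intro: kern_eq_rkern\<close>)
  also have "\<dots> = ennreal (\<integral>p. rkern A \<bar>fst p - snd p\<bar> \<partial>(\<nu> \<Otimes>\<^sub>M \<mu>))"
    by (rule nn_integral_eq_integral[OF integrable_rkern_pair(2)[OF assms] pos])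
  finally show ?thesis .
qed

text \<open>Passes from \<open>ennreal\<close> to real integrals, in which energies may be
  subtracted from one another.\<close>

lemma integral_incr_mult:
  assumes A: "1 \<le> A"
  shows "has_bochner_integral (lborel \<Otimes>\<^sub>M lborel) (\<lambda>(r, z). indicator {0<..<A} r / r\<^sup>2 * (incr \<nu> r z * incr \<mu> r z))
    (\<integral>p. rkern A \<bar>fst p - snd p\<bar> \<partial>(\<nu> \<Otimes>\<^sub>M \<mu>))"
proof (rule has_bochner_integral_nn_integral)
  note borel_measurable_incr[OF real_distributions(1), measurable] borel_measurable_incr[OF real_distributions(2), measurable]
  show "(\<lambda>(r, z). indicator {0<..<A} r / r\<^sup>2 * (incr \<nu> r z * incr \<mu> r z)) \<in> borel_measurable (lborel \<Otimes>\<^sub>M lborel)"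
    by measurable
  show "AE p in lborel \<Otimes>\<^sub>M lborel. 0 \<le> (case p of (r, z) \<Rightarrow> indicator {0<..<A} r / r\<^sup>2 * (incr \<nu> r z * incr \<mu> r z))"
  proof (intro AE_I2, clarsimp)
    fix r z :: real
    show "0 \<le> indicator {0<..<A} r * (incr \<nu> r z * incr \<mu> r z) / r\<^sup>2"
      by (cases "r \<in> {0<..<A}") (simp_all add: incr_nonneg real_distributions)
  qed
  have "AE p in \<nu> \<Otimes>\<^sub>M \<mu>. 0 \<le> rkern A \<bar>fst p - snd p\<bar>"
    using AE_pair_neq by eventually_elim (use assms in \<open>auto intro: rkern_nonneg\<close>)
  then show "0 \<le> (\<integral>p. rkern A \<bar>fst p - snd p\<bar> \<partial>(\<nu> \<Otimes>\<^sub>M \<mu>))"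
    by (rule integral_nonneg_AE)
  show "(\<integral>\<^sup>+ p. ennreal (case p of (r, z) \<Rightarrow> indicator {0<..<A} r / r\<^sup>2 * (incr \<nu> r z * incr \<mu> r z)) \<partial>(lborel \<Otimes>\<^sub>M lborel))
    = ennreal (\<integral>p. rkern A \<bar>fst p - snd p\<bar> \<partial>(\<nu> \<Otimes>\<^sub>M \<mu>))"
    unfolding energy_eq_integral_rkern[OF A, symmetric] energy_eq_pair[OF real_distributions]
    by (simp add: split_beta')
qed

end

text \<open>The energy of the signed measure \<open>\<nu> - \<mu>\<close> for the kernel
  \<open>- ln \<bar>x - y\<bar>\<close>, multiplied out so that only probability measures
  occur.\<close>

definition log_distance :: "real measure \<Rightarrow> real measure \<Rightarrow> real" where
  "log_distance \<nu> \<mu> = 2 * log_energy \<nu> \<mu> - log_energy \<nu> \<nu> - log_energy \<mu> \<mu>"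

lemma log_distance_ge:
  assumes \<nu>: "log_finite \<nu>" and \<mu>: "log_finite \<mu>" and A: "1 \<le> A"
  shows "(\<integral>\<^sup>+(r, z). ennreal (indicator {0<..<A} r / r\<^sup>2 * (incr \<nu> r z - incr \<mu> r z)\<^sup>2) \<partial>(lborel \<Otimes>\<^sub>M lborel))
      \<le> ennreal (log_distance \<nu> \<mu>)" (is ?le)
    and "0 \<le> log_distance \<nu> \<mu>"
proof -
  (* Q A increases with A and tends to log_distance: the summands ln A - 1 cancel because the
     signs of the four products of \<nu> and \<mu> add up to 0. *)
  define g where "g A = (\<lambda>(r, z). indicator {0<..<A} r / r\<^sup>2 * (incr \<nu> r z - incr \<mu> r z)\<^sup>2)" for A
  define R where "R A \<alpha> \<beta> = (\<integral>p. rkern A \<bar>fst p - snd p\<bar> \<partial>(\<alpha> \<Otimes>\<^sub>M \<beta>))" for A \<alpha> \<beta>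
  define Q where "Q A = R A \<nu> \<nu> + R A \<mu> \<mu> - 2 * R A \<nu> \<mu>" for A
  have g: "has_bochner_integral (lborel \<Otimes>\<^sub>M lborel) (g A) (Q A)" if "1 \<le> A" for A
  proof -
    have "g A = (\<lambda>p. (case p of (r, z) \<Rightarrow> indicator {0<..<A} r / r\<^sup>2 * (incr \<nu> r z * incr \<nu> r z))
       + (case p of (r, z) \<Rightarrow> indicator {0<..<A} r / r\<^sup>2 * (incr \<mu> r z * incr \<mu> r z))
       - 2 * (case p of (r, z) \<Rightarrow> indicator {0<..<A} r / r\<^sup>2 * (incr \<nu> r z * incr \<mu> r z)))"
      by (auto simp: g_def fun_eq_iff power2_eq_square indicator_def algebra_simps diff_divide_distrib add_divide_distrib)
    then show ?thesis
      unfolding Q_def R_def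
      by (simp only:, intro has_bochner_integral_add has_bochner_integral_diff has_bochner_integral_mult_right
          integral_incr_mult \<nu> \<mu> that)
  qed
  have "Q A \<le> Q B" if "1 \<le> A" "A \<le> B" for A B
  proof -
    have gAB: "has_bochner_integral (lborel \<Otimes>\<^sub>M lborel) (g A) (Q A)"
      "has_bochner_integral (lborel \<Otimes>\<^sub>M lborel) (g B) (Q B)"
      using that by (auto intro: g)
    have "g A p \<le> g B p" for p
      unfolding g_def split_beta' using that
      by (intro mult_right_mono divide_right_mono) (auto simp: indicator_def)
    then have "integral\<^sup>L (lborel \<Otimes>\<^sub>M lborel) (g A) \<le> integral\<^sup>L (lborel \<Otimes>\<^sub>M lborel) (g B)"
      using gAB by (intro integral_mono) (auto simp: has_bochner_integral_iff)
    then show ?thesis using gAB by (simp add: has_bochner_integral_iff)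
  qed
  then have le: "Q A \<le> Q (real (Suc n))" if "1 \<le> A" "A \<le> real (Suc n)" for A n using that by blast
  have "(\<lambda>n. (R (real (Suc n)) \<nu> \<nu> - ln (real (Suc n)) + 1) + (R (real (Suc n)) \<mu> \<mu> - ln (real (Suc n)) + 1)
      - 2 * (R (real (Suc n)) \<nu> \<mu> - ln (real (Suc n)) + 1))
    \<longlonglongrightarrow> - log_energy \<nu> \<nu> + - log_energy \<mu> \<mu> - 2 * (- log_energy \<nu> \<mu>)"
    unfolding R_def by (intro tendsto_intros tendsto_integral_rkern \<nu> \<mu>)
  then have "(\<lambda>n. Q (real (Suc n))) \<longlonglongrightarrow> log_distance \<nu> \<mu>"
    by (simp add: Q_def log_distance_def algebra_simps)
  then have Q: "Q A \<le> log_distance \<nu> \<mu>"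
  proof (rule LIMSEQ_le_const, intro exI allI impI)
    fix n assume "n \<ge> nat \<lceil>A\<rceil>"
    then show "Q A \<le> Q (real (Suc n))" using A by (intro le) linarith+
  qed
  have pos: "0 \<le> g A p" for p by (auto simp: g_def split_beta')
  have Qpos: "0 \<le> Q A" 
    unfolding has_bochner_integral_integral_eq[OF g[OF A], symmetric] by (rule integral_nonneg_AE) (simp add: pos)
  have "(\<integral>\<^sup>+p. ennreal (g A p) \<partial>(lborel \<Otimes>\<^sub>M lborel)) = ennreal (Q A)"
    using g[OF A] pos by (simp add: has_bochner_integral_iff nn_integral_eq_integral)
  also have "\<dots> \<le> ennreal (log_distance \<nu> \<mu>)" using Q by (rule ennreal_leI)
  finally show ?le by (simp add: g_def split_beta')
  show "0 \<le> log_distance \<nu> \<mu>" using Qpos Q by simp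
qed

lemma log_energy_sym:
  assumes "log_finite \<nu>" "log_finite \<mu>"
  shows "log_energy \<mu> \<nu> = log_energy \<nu> \<mu>"
proof -
  interpret N: real_distribution \<nu> using assms by (simp add: log_finite_def)
  interpret M: real_distribution \<mu> using assms by (simp add: log_finite_def)
  interpret P: pair_sigma_finite \<nu> \<mu> ..
  show ?thesis
    unfolding log_energy_def
    using P.integral_product_swap[of "\<lambda>p. ln \<bar>fst p - snd p\<bar>"] measurable_pair_diff[OF assms, of ln]
    by (simp add: split_beta' abs_minus_commute)
qed

section \<open>Mixtures\<close>

text \<open>For \<open>0 \<le> t \<le> 1\<close> this is the convex combination
  \<open>t \<nu> + (1 - t) \<mu>\<close>: a Bernoulli variable decides from which measure to draw,
  so integrals against it follow from the rule for \<open>bind\<close>.\<close>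

definition mixture :: "real \<Rightarrow> real measure \<Rightarrow> real measure \<Rightarrow> real measure" where
  "mixture t \<nu> \<mu> = measure_pmf (bernoulli_pmf t) \<bind> (\<lambda>b. if b then \<nu> else \<mu>)"

lemma
  assumes \<nu>: "real_distribution \<nu>" and \<mu>: "real_distribution \<mu>" and t: "0 \<le> t" "t \<le> 1"
  shows nn_integral_mixture: "f \<in> borel_measurable borel \<Longrightarrow>
      (\<integral>\<^sup>+x. f x \<partial>mixture t \<nu> \<mu>) = ennreal t * (\<integral>\<^sup>+x. f x \<partial>\<nu>) + ennreal (1 - t) * (\<integral>\<^sup>+x. f x \<partial>\<mu>)"
    and real_distribution_mixture: "real_distribution (mixture t \<nu> \<mu>)"
proof -
  interpret N: real_distribution \<nu> by fact
  interpret M: real_distribution \<mu> by fact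
  have k: "(\<lambda>b. if b then \<nu> else \<mu>) \<in> measure_pmf (bernoulli_pmf t) \<rightarrow>\<^sub>M subprob_algebra borel"
    by (auto simp: space_subprob_algebra N.subprob_space_axioms M.subprob_space_axioms)
  show nn: "(\<integral>\<^sup>+x. f x \<partial>mixture t \<nu> \<mu>) = ennreal t * (\<integral>\<^sup>+x. f x \<partial>\<nu>) + ennreal (1 - t) * (\<integral>\<^sup>+x. f x \<partial>\<mu>)"
    if "f \<in> borel_measurable borel" for f
    unfolding mixture_def using t
    by (subst nn_integral_bind[OF that k]) (simp add: ac_simps)
  have sets: "sets (mixture t \<nu> \<mu>) = sets borel"
    unfolding mixture_def by (rule sets_bind) auto
  have "emeasure (mixture t \<nu> \<mu>) (space (mixture t \<nu> \<mu>)) = 1"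
    using nn[of "\<lambda>_. 1"] t N.emeasure_space_1 M.emeasure_space_1
    by (simp flip: ennreal_plus)
  then show "real_distribution (mixture t \<nu> \<mu>)"
    by (intro real_distribution.intro real_distribution_axioms.intro prob_spaceI sets)
qed

text \<open>Transfers a linear relation from nonnegative integrals to real ones through positive and
  negative parts. It is kept abstract because it serves both a mixture on the line and products in
  which one factor is a mixture.\<close>

lemma integral_of_nn_integral_combination:
  fixes f :: "'a \<Rightarrow> real"
  assumes nn: "\<And>f. f \<in> borel_measurable N \<Longrightarrow>
      (\<integral>\<^sup>+x. f x \<partial>N) = ennreal a * (\<integral>\<^sup>+x. f x \<partial>M) + ennreal b * (\<integral>\<^sup>+x. f x \<partial>M')"
    and ab: "0 \<le> a" "0 \<le> b" and sets: "sets N = sets M"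
    and f: "integrable M f" "integrable M' f"
  shows "integrable N f" "(\<integral>x. f x \<partial>N) = a * (\<integral>x. f x \<partial>M) + b * (\<integral>x. f x \<partial>M')"
proof -
  have [measurable]: "f \<in> borel_measurable N"
    using f(1) measurable_cong_sets[OF sets refl] by (auto dest: borel_measurable_integrable)
  have fin: "(\<integral>\<^sup>+x. ennreal (f x) \<partial>M) < \<infinity>" "(\<integral>\<^sup>+x. ennreal (- f x) \<partial>M) < \<infinity>"
    "(\<integral>\<^sup>+x. ennreal (f x) \<partial>M') < \<infinity>" "(\<integral>\<^sup>+x. ennreal (- f x) \<partial>M') < \<infinity>"
    using f by (auto simp: real_integrable_def less_top)
  show int: "integrable N f"
    unfolding real_integrable_def using fin by (auto simp: nn ennreal_mult_eq_top_iff less_top)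
  have *: "enn2real (ennreal a * x + ennreal b * y) = a * enn2real x + b * enn2real y"
    if "x < \<infinity>" "y < \<infinity>" for x y
    using that ab by (subst enn2real_plus) (auto simp: enn2real_mult ennreal_mult_less_top less_top)
  show "(\<integral>x. f x \<partial>N) = a * (\<integral>x. f x \<partial>M) + b * (\<integral>x. f x \<partial>M')"
    unfolding real_lebesgue_integral_def[OF int] real_lebesgue_integral_def[OF f(1)] real_lebesgue_integral_def[OF f(2)]
    using fin by (simp add: nn * algebra_simps)
qed

lemma
  assumes \<nu>: "real_distribution \<nu>" and \<mu>: "real_distribution \<mu>" and \<kappa>: "real_distribution \<kappa>"
    and t: "0 \<le> t" "t \<le> 1"
  shows nn_integral_mixture_pair1: "f \<in> borel_measurable (borel \<Otimes>\<^sub>M borel) \<Longrightarrow>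
      (\<integral>\<^sup>+p. f p \<partial>(mixture t \<nu> \<mu> \<Otimes>\<^sub>M \<kappa>)) = ennreal t * (\<integral>\<^sup>+p. f p \<partial>(\<nu> \<Otimes>\<^sub>M \<kappa>)) + ennreal (1 - t) * (\<integral>\<^sup>+p. f p \<partial>(\<mu> \<Otimes>\<^sub>M \<kappa>))"
    and nn_integral_mixture_pair2: "f \<in> borel_measurable (borel \<Otimes>\<^sub>M borel) \<Longrightarrow>
      (\<integral>\<^sup>+p. f p \<partial>(\<kappa> \<Otimes>\<^sub>M mixture t \<nu> \<mu>)) = ennreal t * (\<integral>\<^sup>+p. f p \<partial>(\<kappa> \<Otimes>\<^sub>M \<nu>)) + ennreal (1 - t) * (\<integral>\<^sup>+p. f p \<partial>(\<kappa> \<Otimes>\<^sub>M \<mu>))"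
proof -
  interpret N: real_distribution \<nu> by fact
  interpret M: real_distribution \<mu> by fact
  interpret K: real_distribution \<kappa> by fact
  interpret T: real_distribution "mixture t \<nu> \<mu>" by (rule real_distribution_mixture) fact+
  have [measurable_cong]: "sets \<nu> = sets borel" "sets \<mu> = sets borel" "sets \<kappa> = sets borel" by simp_all
  {
    assume [measurable]: "f \<in> borel_measurable (borel \<Otimes>\<^sub>M borel)"
    show "(\<integral>\<^sup>+p. f p \<partial>(mixture t \<nu> \<mu> \<Otimes>\<^sub>M \<kappa>)) = ennreal t * (\<integral>\<^sup>+p. f p \<partial>(\<nu> \<Otimes>\<^sub>M \<kappa>)) + ennreal (1 - t) * (\<integral>\<^sup>+p. f p \<partial>(\<mu> \<Otimes>\<^sub>M \<kappa>))"
      by (simp add: K.nn_integral_fst[symmetric] nn_integral_mixture[OF \<nu> \<mu> t])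
    show "(\<integral>\<^sup>+p. f p \<partial>(\<kappa> \<Otimes>\<^sub>M mixture t \<nu> \<mu>)) = ennreal t * (\<integral>\<^sup>+p. f p \<partial>(\<kappa> \<Otimes>\<^sub>M \<nu>)) + ennreal (1 - t) * (\<integral>\<^sup>+p. f p \<partial>(\<kappa> \<Otimes>\<^sub>M \<mu>))"
      by (simp add: T.nn_integral_fst[symmetric] N.nn_integral_fst[symmetric] M.nn_integral_fst[symmetric]
          nn_integral_mixture[OF \<nu> \<mu> t] nn_integral_add nn_integral_cmult)
  }
qed

lemma
  assumes \<nu>: "log_finite \<nu>" and \<mu>: "log_finite \<mu>" and t: "0 \<le> t" "t \<le> 1"
  shows log_finite_mixture: "log_finite (mixture t \<nu> \<mu>)"
    and log_energy_mixture: "log_energy (mixture t \<nu> \<mu>) (mixture t \<nu> \<mu>)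
      = t\<^sup>2 * log_energy \<nu> \<nu> + 2 * t * (1 - t) * log_energy \<nu> \<mu> + (1 - t)\<^sup>2 * log_energy \<mu> \<mu>"
proof -
  let ?m = "mixture t \<nu> \<mu>"
  have r: "real_distribution \<nu>" "real_distribution \<mu>" using \<nu> \<mu> by (auto simp: log_finite_def)
  have rm: "real_distribution ?m" by (rule real_distribution_mixture[OF r t])
  have [simp]: "sets \<nu> = sets borel" "sets \<mu> = sets borel" "sets ?m = sets borel"
    using r rm by (auto simp: real_distribution.events_eq_borel)
  note nn1 = nn_integral_mixture[OF r t]
  note p1 = nn_integral_mixture_pair1[OF r _ t]
  note p2 = nn_integral_mixture_pair2[OF r _ t]
  have sp: "sets (\<alpha> \<Otimes>\<^sub>M \<beta>) = sets (borel \<Otimes>\<^sub>M borel)" if "real_distribution \<alpha>" "real_distribution \<beta>" for \<alpha> \<beta>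
    using that by (intro sets_pair_measure_cong) (auto simp: real_distribution.events_eq_borel)
  have meas: "f \<in> borel_measurable (borel \<Otimes>\<^sub>M borel)"
    if "f \<in> borel_measurable (\<alpha> \<Otimes>\<^sub>M \<beta>)" "real_distribution \<alpha>" "real_distribution \<beta>"
    for f :: "real \<times> real \<Rightarrow> ennreal" and \<alpha> \<beta>
    using that measurable_cong_sets[OF sp[OF that(2,3)] refl] by auto
  have x: "integrable ?m (\<lambda>x. x)"
    by (rule integral_of_nn_integral_combination[of ?m t \<nu> "1 - t" \<mu>])
       (use nn1 t \<nu> \<mu> in \<open>auto simp: log_finite_def cong: measurable_cong_sets\<close>)
  have k: "(\<lambda>p. kern 1 \<bar>fst p - snd p\<bar>) \<in> borel_measurable (borel \<Otimes>\<^sub>M borel)" by measurable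
  have "energy 1 ?m ?m < \<infinity>"
    using energy_finite[OF \<nu> \<nu>] energy_finite[OF \<mu> \<mu>] energy_finite[OF \<nu> \<mu>] energy_finite[OF \<mu> \<nu>]
    unfolding energy_eq_pair_kern[OF rm rm] p1[OF rm k] p2[OF r(1) k] p2[OF r(2) k]
      energy_eq_pair_kern[OF r(1) r(1), symmetric] energy_eq_pair_kern[OF r(2) r(2), symmetric]
      energy_eq_pair_kern[OF r(1) r(2), symmetric] energy_eq_pair_kern[OF r(2) r(1), symmetric]
    by (simp add: ennreal_mult_less_top)
  then show "log_finite ?m" using x rm by (simp add: log_finite_def)
  \<comment> \<open>The second factor is expanded for an arbitrary first one; the first factor is
    expanded afterwards, and the two cross terms are merged by symmetry.\<close>
  have e2: "integrable (\<kappa> \<Otimes>\<^sub>M ?m) (\<lambda>p. ln \<bar>fst p - snd p\<bar>) \<and>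
      log_energy \<kappa> ?m = t * log_energy \<kappa> \<nu> + (1 - t) * log_energy \<kappa> \<mu>" if \<kappa>: "log_finite \<kappa>" for \<kappa>
  proof -
    have rk: "real_distribution \<kappa>" using \<kappa> by (simp add: log_finite_def)
    show ?thesis
      unfolding log_energy_def
      by (intro conjI integral_of_nn_integral_combination[of "\<kappa> \<Otimes>\<^sub>M ?m" t "\<kappa> \<Otimes>\<^sub>M \<nu>" "1 - t" "\<kappa> \<Otimes>\<^sub>M \<mu>"]
          integrable_ln_pair \<kappa> \<nu> \<mu> p2[OF rk] meas[OF _ rk rm])
        (use t sp rk r rm in auto)
  qed
  have "log_energy ?m ?m = t * log_energy \<nu> ?m + (1 - t) * log_energy \<mu> ?m"
    unfolding log_energy_def
    by (intro integral_of_nn_integral_combination(2)[of "?m \<Otimes>\<^sub>M ?m" t "\<nu> \<Otimes>\<^sub>M ?m" "1 - t" "\<mu> \<Otimes>\<^sub>M ?m"]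
        p1[OF rm] meas[OF _ rm rm]) (use t sp r rm e2 \<nu> \<mu> in auto)
  also have "\<dots> = t\<^sup>2 * log_energy \<nu> \<nu> + 2 * t * (1 - t) * log_energy \<nu> \<mu> + (1 - t)\<^sup>2 * log_energy \<mu> \<mu>"
    unfolding e2[OF \<nu>, THEN conjunct2] e2[OF \<mu>, THEN conjunct2] log_energy_sym[OF \<nu> \<mu>]
    by (simp add: power2_eq_square algebra_simps)
  finally show "log_energy ?m ?m
      = t\<^sup>2 * log_energy \<nu> \<nu> + 2 * t * (1 - t) * log_energy \<nu> \<mu> + (1 - t)\<^sup>2 * log_energy \<mu> \<mu>" .
qed

section \<open>Finiteness of the functional\<close>

text \<open>Agreement almost everywhere is the right condition, because \<open>log_dist\<close> is
  infinite on the diagonal, where no real-valued function can agree with it.\<close>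

lemma ext_integral_eq_integral:
  assumes "integrable M g" "AE x in M. f x = ereal (g x)"
  shows "ext_integral M f = ereal (\<integral>x. g x \<partial>M)"
proof -
  have "(\<integral>\<^sup>+ x. e2ennreal (f x) \<partial>M) = (\<integral>\<^sup>+ x. ennreal (g x) \<partial>M)"
    "(\<integral>\<^sup>+ x. e2ennreal (- f x) \<partial>M) = (\<integral>\<^sup>+ x. ennreal (- g x) \<partial>M)"
    by (rule nn_integral_cong_AE, use assms(2) in eventually_elim, simp)+
  moreover have "(\<integral>\<^sup>+ x. ennreal (g x) \<partial>M) < top" "(\<integral>\<^sup>+ x. ennreal (- g x) \<partial>M) < top"
    using assms(1) by (auto simp: real_integrable_def less_top)
  then have "enn2ereal (\<integral>\<^sup>+ x. ennreal (g x) \<partial>M) = ereal (enn2real (\<integral>\<^sup>+ x. ennreal (g x) \<partial>M))"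
    "enn2ereal (\<integral>\<^sup>+ x. ennreal (- g x) \<partial>M) = ereal (enn2real (\<integral>\<^sup>+ x. ennreal (- g x) \<partial>M))"
    by (metis ennreal_enn2real enn2ereal_ennreal enn2real_nonneg)+
  ultimately show ?thesis
    unfolding ext_integral_def real_lebesgue_integral_def[OF assms(1)] by simp
qed

lemma J_eq:
  assumes "log_finite \<nu>" "integrable \<nu> V"
  shows "J V \<nu> = ereal ((\<integral>x. V x \<partial>\<nu>) - log_energy \<nu> \<nu>)"
proof -
  have "ext_integral (\<nu> \<Otimes>\<^sub>M \<nu>) (\<lambda>(x, y). log_dist x y) = ereal (log_energy \<nu> \<nu>)"
    unfolding log_energy_def
    by (rule ext_integral_eq_integral[OF integrable_ln_pair[OF assms(1) assms(1)]],
        use AE_pair_neq[OF assms(1) assms(1)] in eventually_elim) (simp add: log_dist_def split_beta')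
  moreover have "ext_integral \<nu> (\<lambda>x. ereal (V x)) = ereal (\<integral>x. V x \<partial>\<nu>)"
    by (rule ext_integral_eq_integral[OF assms(2)]) simp
  ultimately show ?thesis by (simp add: J_def)
qed

text \<open>The lower limit gives the quadratic bound outside some
  \<open>{-\<bar>K\<bar>..\<bar>K\<bar>}\<close>. On that compact interval the continuous
  \<open>V\<close> is bounded, and \<open>b\<close> absorbs both this bound and the largest value of
  \<open>a * x\<^sup>2\<close> there.\<close>

lemma potential_growth:
  fixes V :: "real \<Rightarrow> real"
  assumes "continuous_on UNIV V" and "Liminf at_infinity (\<lambda>x. ereal (V x / x\<^sup>2)) > 0"
  obtains a b where "0 < a" "0 \<le> b" "\<And>x. a * x\<^sup>2 - b \<le> V x"
proof -
  obtain a where a: "0 < ereal a" "ereal a < Liminf at_infinity (\<lambda>x. ereal (V x / x\<^sup>2))"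
    using ereal_dense2[OF assms(2)] by auto
  have "\<forall>\<^sub>F x in at_infinity. ereal a < ereal (V x / x\<^sup>2)"
    using le_Liminf_iff[THEN iffD1, OF order_refl, rule_format, OF a(2)] .
  then obtain K where K: "\<And>x. K \<le> \<bar>x\<bar> \<Longrightarrow> a < V x / x\<^sup>2"
    unfolding eventually_at_infinity by auto
  have "bounded (V ` {- \<bar>K\<bar>..\<bar>K\<bar>})"
    by (intro compact_imp_bounded compact_continuous_image continuous_on_subset[OF assms(1)]) auto
  then obtain B where "\<forall>y\<in>V ` {- \<bar>K\<bar>..\<bar>K\<bar>}. norm y \<le> B"
    unfolding bounded_iff by blast
  then have B: "\<bar>V x\<bar> \<le> B" if "x \<in> {- \<bar>K\<bar>..\<bar>K\<bar>}" for x
    using that by simp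
  have "0 < a" using a by simp
  moreover have "0 \<le> \<bar>B\<bar> + a * K\<^sup>2" using \<open>0 < a\<close> by simp
  moreover have "a * x\<^sup>2 - (\<bar>B\<bar> + a * K\<^sup>2) \<le> V x" for x
  proof (cases "\<bar>x\<bar> \<le> \<bar>K\<bar>")
    case True
    then have "x\<^sup>2 \<le> K\<^sup>2" by (simp add: abs_le_square_iff)
    then have "a * x\<^sup>2 \<le> a * K\<^sup>2" using \<open>0 < a\<close> by simp
    moreover have "\<bar>V x\<bar> \<le> B" using True by (intro B) auto
    ultimately show ?thesis by linarith
  next
    case False
    then have "a < V x / x\<^sup>2" "x\<^sup>2 > 0" by (auto intro: K)
    then have "a * x\<^sup>2 < V x" by (simp add: field_simps)
    moreover have "0 \<le> a * K\<^sup>2" using \<open>0 < a\<close> by simp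
    ultimately show ?thesis by linarith
  qed
  ultimately show thesis using that by blast
qed

text \<open>\<open>uniform_measure \<nu> S\<close> is \<nu> conditioned on \<open>S\<close>. Its
  density with respect to \<nu> is at most \<open>1 / measure \<nu> S\<close>, so the energy grows
  at most by the square of this factor.\<close>

lemma log_finite_uniform_measure:
  assumes \<nu>: "log_finite \<nu>" and S: "S \<in> sets borel" "0 < measure \<nu> S"
  shows "log_finite (uniform_measure \<nu> S)"
    and "integrable \<nu> f \<Longrightarrow> integrable (uniform_measure \<nu> S) (f :: real \<Rightarrow> real)"
    and "integrable \<nu> f \<Longrightarrow>
      (\<integral>x. f x \<partial>uniform_measure \<nu> S) = (\<integral>x. indicator S x * f x \<partial>\<nu>) / measure \<nu> S"
proof -
  interpret N: real_distribution \<nu> using \<nu> by (simp add: log_finite_def)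
  have [measurable_cong]: "sets \<nu> = sets borel" by simp
  have S'[measurable]: "S \<in> sets \<nu>" using S by simp
  have em: "emeasure \<nu> S = ennreal (measure \<nu> S)" by (rule N.emeasure_eq_measure)
  have "indicator S x / emeasure \<nu> S = ennreal (indicator S x / measure \<nu> S)" for x
    using S(2) unfolding em by (auto simp: indicator_def divide_ennreal[symmetric])
  then have d: "uniform_measure \<nu> S = density \<nu> (\<lambda>x. ennreal (indicator S x / measure \<nu> S))"
    unfolding uniform_measure_def by simp
  have int: "integrable \<nu> (\<lambda>x. indicator S x * g x / measure \<nu> S)" if "integrable \<nu> g" for g :: "real \<Rightarrow> real"
    using integrable_mult_indicator[OF S' that] by simp
  show intu: "integrable (uniform_measure \<nu> S) f" if f: "integrable \<nu> f" for f :: "real \<Rightarrow> real"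
    unfolding d using f int[OF f] by (subst integrable_real_density) auto
  {
    fix f :: "real \<Rightarrow> real" assume f: "integrable \<nu> f"
    show "(\<integral>x. f x \<partial>uniform_measure \<nu> S) = (\<integral>x. indicator S x * f x \<partial>\<nu>) / measure \<nu> S"
      unfolding d using f by (subst integral_real_density) auto
  }
  have x: "integrable (uniform_measure \<nu> S) (\<lambda>x. x)"
    using \<nu> by (intro intu) (simp add: log_finite_def)
  have p: "prob_space (uniform_measure \<nu> S)"
    using S by (intro prob_space_uniform_measure) (auto simp: em)
  let ?c = "ennreal (1 / measure \<nu> S)"
  have le: "(\<integral>\<^sup>+x. g x \<partial>uniform_measure \<nu> S) \<le> ?c * (\<integral>\<^sup>+x. g x \<partial>\<nu>)" if [measurable]: "g \<in> borel_measurable borel" for g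
  proof -
    have "(\<integral>\<^sup>+x. g x \<partial>uniform_measure \<nu> S) = (\<integral>\<^sup>+x. ennreal (indicator S x / measure \<nu> S) * g x \<partial>\<nu>)"
      unfolding d by (subst nn_integral_density) auto
    also have "\<dots> \<le> (\<integral>\<^sup>+x. ?c * g x \<partial>\<nu>)"
      by (intro nn_integral_mono mult_right_mono ennreal_leI divide_right_mono) (auto simp: indicator_def)
    finally show ?thesis by (simp add: nn_integral_cmult)
  qed
  have km: "(\<lambda>x. \<integral>\<^sup>+y. kern 1 \<bar>x - y\<bar> \<partial>\<rho>) \<in> borel_measurable borel" if "real_distribution \<rho>" for \<rho>
  proof -
    interpret R: real_distribution \<rho> by fact
    have [measurable_cong]: "sets \<rho> = sets borel" by simp
    show ?thesis by measurable
  qed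
  have "energy 1 (uniform_measure \<nu> S) (uniform_measure \<nu> S)
      \<le> (\<integral>\<^sup>+x. ?c * (\<integral>\<^sup>+y. kern 1 \<bar>x - y\<bar> \<partial>\<nu>) \<partial>uniform_measure \<nu> S)"
    unfolding energy_def by (intro nn_integral_mono le) measurable
  also have "\<dots> = ?c * (\<integral>\<^sup>+x. (\<integral>\<^sup>+y. kern 1 \<bar>x - y\<bar> \<partial>\<nu>) \<partial>uniform_measure \<nu> S)"
    using km[OF N.real_distribution_axioms] by (intro nn_integral_cmult) (simp cong: measurable_cong_sets)
  also have "\<dots> \<le> ?c * (?c * energy 1 \<nu> \<nu>)"
    unfolding energy_def by (intro mult_left_mono le km N.real_distribution_axioms) auto
  also have "\<dots> < \<infinity>" using \<nu> by (simp add: log_finite_def ennreal_mult_less_top)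
  finally show "log_finite (uniform_measure \<nu> S)"
    using x p by (simp add: log_finite_def real_distribution_def real_distribution_axioms_def)
qed

text \<open>A competitor with finite \<open>J V\<close>, which shows that the infimum is below
  \<open>\<infinity>\<close>. Its density is at most 1, so a window of length \<open>r\<close> has
  mass at most \<open>r\<close>, which cancels the weight \<open>1 / r\<^sup>2\<close> in the
  energy; for \<open>r < 1\<close> only \<open>z\<close> in \<open>{-1..1}\<close>
  contribute.\<close>

lemma log_finite_unit_interval:
  "log_finite (uniform_measure lborel {0..1})"
  "continuous_on UNIV V \<Longrightarrow> integrable (uniform_measure lborel {0..1}) (V :: real \<Rightarrow> real)"
proof -
  let ?u = "uniform_measure lborel {0..1::real}"
  have p: "prob_space ?u" by (intro prob_space_uniform_measure) auto
  then have r: "real_distribution ?u" by (simp add: real_distribution_def real_distribution_axioms_def)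
  interpret U: real_distribution ?u by fact
  have AE: "AE x in ?u. x \<in> {0..1}" by (intro AE_uniform_measureI) auto
  show int: "integrable ?u V" if V: "continuous_on UNIV V" for V :: "real \<Rightarrow> real"
  proof -
    have "bounded (V ` {0..1})"
      by (intro compact_imp_bounded compact_continuous_image continuous_on_subset[OF V]) auto
    then obtain B where "\<forall>y\<in>V ` {0..1}. norm y \<le> B" unfolding bounded_iff by blast
    then have "AE x in ?u. norm (V x) \<le> B" using AE by auto
    then show ?thesis
      using borel_measurable_continuous_onI[OF V] by (intro U.integrable_const_bound) auto
  qed
  have inc: "incr ?u r z \<le> indicator {-1..1} z * r" if "0 < r" "r < 1" for r z
  proof -
    have "incr ?u r z = measure ?u {z<..z + r}"
      unfolding incr_def using that by (intro U.cdf_diff_eq) simp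
    also have "\<dots> = measure lborel ({0..1} \<inter> {z<..z + r})" by simp
    also have "\<dots> \<le> indicator {-1..1} z * r"
    proof (cases "z \<in> {-1..1}")
      case True
      have "measure lborel ({0..1} \<inter> {z<..z + r}) \<le> measure lborel {z<..z + r}"
        using that by (intro measure_mono_fmeasurable) (auto simp: fmeasurable_def)
      with True that show ?thesis by simp
    next
      case False
      then have "{0..1} \<inter> {z<..z + r} = {}" using that by auto
      with False show ?thesis by simp
    qed
    finally show ?thesis .
  qed
  have "energy 1 ?u ?u \<le> (\<integral>\<^sup>+p. indicator ({0..1} \<times> {-1..1}) (p :: real \<times> real) \<partial>(lborel \<Otimes>\<^sub>M lborel))"
    unfolding energy_eq_pair[OF r r]
  proof (rule nn_integral_mono)
    fix p :: "real \<times> real"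
    obtain s z where p: "p = (s, z)" by (cases p)
    show "(case p of (s, z) \<Rightarrow> ennreal (indicator {0<..<1} s / s\<^sup>2 * (incr ?u s z * incr ?u s z)))
        \<le> indicator ({0..1} \<times> {-1..1}) p"
    proof (cases "s \<in> {0<..<1}")
      case True
      then have s: "0 < s" "s < 1" by auto
      have "incr ?u s z * incr ?u s z \<le> (indicator {-1..1} z * s) * (indicator {-1..1} z * s)"
        using s by (intro mult_mono inc incr_nonneg r) auto
      then have "incr ?u s z * incr ?u s z / s\<^sup>2 \<le> indicator {-1..1} z"
        using s by (auto simp: field_simps power2_eq_square indicator_def split: if_splits)
      then have "ennreal (incr ?u s z * incr ?u s z / s\<^sup>2) \<le> ennreal (indicator {-1..1} z)"
        by (rule ennreal_leI)
      then have "ennreal (indicator {0<..<1} s / s\<^sup>2 * (incr ?u s z * incr ?u s z)) \<le> ennreal (indicator {-1..1} z)"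
        using s by simp
      also have "\<dots> = indicator ({0..1} \<times> {-1..1}) p"
        using s by (simp add: p indicator_def)
      finally show ?thesis by (simp only: p prod.case)
    qed (simp add: p)
  qed
  also have "\<dots> = emeasure lborel {0..1::real} * emeasure lborel {-1..1::real}"
    by (subst nn_integral_indicator) (auto simp: lborel.emeasure_pair_measure_Times)
  also have "\<dots> < \<infinity>" by (simp add: ennreal_mult_less_top)
  finally show "log_finite ?u" using r int[of "\<lambda>x. x"] by (simp add: log_finite_def continuous_on_id)
qed

lemma c_min_less_infinity:
  assumes "continuous_on UNIV V"
  shows "c_min V < \<infinity>"
proof -
  have "c_min V \<le> J V (uniform_measure lborel {0..1})"
    unfolding c_min_def using log_finite_unit_interval(1) by (intro INF_lower) (simp add: log_finite_def)
  also have "\<dots> < \<infinity>"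
    using J_eq[OF log_finite_unit_interval(1) log_finite_unit_interval(2)[OF assms]] by simp
  finally show ?thesis .
qed

lemma integrable_square_of_growth:
  assumes "real_distribution \<nu>" "integrable \<nu> V" "0 < a" and g: "\<And>x. a * x\<^sup>2 - b \<le> V x"
  shows "integrable \<nu> (\<lambda>x. x\<^sup>2)"
proof -
  interpret N: real_distribution \<nu> by fact
  have [measurable_cong]: "sets \<nu> = sets borel" by simp
  show ?thesis
  proof (rule Bochner_Integration.integrable_bound)
    show "integrable \<nu> (\<lambda>x. (V x + b) / a)" using assms by simp
    show "AE x in \<nu>. norm (x\<^sup>2) \<le> norm ((V x + b) / a)"
    proof (intro AE_I2)
      fix x
      have "x\<^sup>2 \<le> (V x + b) / a" using g[of x] \<open>0 < a\<close> by (simp add: field_simps)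
      then show "norm (x\<^sup>2) \<le> norm ((V x + b) / a)" using abs_ge_self[of "(V x + b) / a"]
        by (simp del: abs_divide)
    qed
  qed measurable
qed

text \<open>Reduces the theorem to measures on which real-valued calculus is available. As
  \<open>V\<close> is bounded below, an infinite integral of \<open>V\<close> would give
  \<open>J V \<nu> = \<infinity>\<close>. Given finite second moments, the positive part of the
  logarithm is integrable, so infinite energy would make the logarithmic integral
  \<open>- \<infinity>\<close> and again \<open>J V \<nu> = \<infinity>\<close>.\<close>

lemma J_finite_imp:
  assumes \<nu>: "real_distribution \<nu>" and V: "continuous_on UNIV V"
    and a: "0 < a" "0 \<le> b" and g: "\<And>x. a * x\<^sup>2 - b \<le> V x" and J: "J V \<nu> \<noteq> \<infinity>"
  shows "log_finite \<nu>" "integrable \<nu> V"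
proof -
  interpret N: real_distribution \<nu> by fact
  have [measurable_cong]: "sets \<nu> = sets borel" by simp
  note borel_measurable_continuous_onI[OF V, measurable]
  have "(\<integral>\<^sup>+x. ennreal (- V x) \<partial>\<nu>) \<le> (\<integral>\<^sup>+x. ennreal b \<partial>\<nu>)"
  proof (intro nn_integral_mono ennreal_leI)
    fix x have "0 \<le> a * x\<^sup>2" using a by simp
    with g[of x] show "- V x \<le> b" by linarith
  qed
  also have "\<dots> < \<infinity>" using N.emeasure_space_1 by simp
  finally have neg: "(\<integral>\<^sup>+x. ennreal (- V x) \<partial>\<nu>) < \<infinity>" .
  have "(\<integral>\<^sup>+x. ennreal (V x) \<partial>\<nu>) < \<infinity>"
  proof (rule ccontr)
    assume "\<not> (\<integral>\<^sup>+x. ennreal (V x) \<partial>\<nu>) < \<infinity>"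
    then have "ext_integral \<nu> (\<lambda>x. ereal (V x)) = \<infinity>"
      using neg unfolding ext_integral_def by (cases "\<integral>\<^sup>+x. ennreal (- V x) \<partial>\<nu>") (auto simp: less_top[symmetric])
    with J show False by (simp add: J_def)
  qed
  with neg show int: "integrable \<nu> V" by (auto simp: real_integrable_def less_top)
  have sq: "integrable \<nu> (\<lambda>x. x\<^sup>2)" by (rule integrable_square_of_growth[OF \<nu> int a(1) g])
  have id: "integrable \<nu> (\<lambda>x. x)"
  proof (rule Bochner_Integration.integrable_bound)
    show "integrable \<nu> (\<lambda>x. 1 + x\<^sup>2)" using sq by simp
    have "norm x \<le> norm (1 + x\<^sup>2)" for x :: real
      using sum_squares_bound[of 1 "\<bar>x\<bar>"] by simp
    then show "AE x in \<nu>. norm x \<le> norm (1 + x\<^sup>2)" by simp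
  qed measurable
  have "energy 1 \<nu> \<nu> \<noteq> \<infinity>"
  proof
    assume inf: "energy 1 \<nu> \<nu> = \<infinity>"
    have [measurable]: "(\<lambda>p. e2ennreal (- (case p of (x, y) \<Rightarrow> log_dist x y))) \<in> borel_measurable (\<nu> \<Otimes>\<^sub>M \<nu>)"
      unfolding log_dist_def by measurable
    \<comment> \<open>The truncated kernel lies below the negative part of the logarithm, with both
      sides infinite on the diagonal.\<close>
    have "kern 1 \<bar>x - y\<bar> \<le> e2ennreal (- log_dist x y)" for x y
    proof (cases "x = y")
      case False
      then have u: "0 < \<bar>x - y\<bar>" by simp
      have "rkern 1 \<bar>x - y\<bar> \<le> max 0 (- ln \<bar>x - y\<bar>)" using u by (simp add: rkern_def)
      then show ?thesis using False kern_eq_rkern[OF u, of 1]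
        by (simp add: log_dist_def) (metis ennreal_leI ennreal_max_0)
    qed (simp add: log_dist_def)
    then have "energy 1 \<nu> \<nu> \<le> (\<integral>\<^sup>+p. e2ennreal (- (case p of (x, y) \<Rightarrow> log_dist x y)) \<partial>(\<nu> \<Otimes>\<^sub>M \<nu>))"
      unfolding energy_eq_pair_kern[OF \<nu> \<nu>] by (intro nn_integral_mono) (simp add: split_beta')
    then have n: "(\<integral>\<^sup>+p. e2ennreal (- (case p of (x, y) \<Rightarrow> log_dist x y)) \<partial>(\<nu> \<Otimes>\<^sub>M \<nu>)) = \<infinity>"
      using inf by (simp add: top_unique)
    interpret P: pair_prob_space \<nu> \<nu> ..
    have ab: "integrable (\<nu> \<Otimes>\<^sub>M \<nu>) (\<lambda>p. \<bar>fst p\<bar> + \<bar>snd p\<bar>)"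
      using integrable_fst_snd_pair[OF \<nu> \<nu>, of abs abs] id by simp
    have "(\<integral>\<^sup>+p. e2ennreal (case p of (x, y) \<Rightarrow> log_dist x y) \<partial>(\<nu> \<Otimes>\<^sub>M \<nu>))
        \<le> (\<integral>\<^sup>+p. ennreal (\<bar>fst p\<bar> + \<bar>snd p\<bar>) \<partial>(\<nu> \<Otimes>\<^sub>M \<nu>))"
    proof (intro nn_integral_mono, clarsimp simp only: split_paired_all prod.case fst_conv snd_conv)
      fix x y :: real
      show "e2ennreal (log_dist x y) \<le> ennreal (\<bar>x\<bar> + \<bar>y\<bar>)"
      proof (cases "x = y")
        case False
        then have "ln \<bar>x - y\<bar> \<le> \<bar>x\<bar> + \<bar>y\<bar>"
          using ln_le_minus_one[of "\<bar>x - y\<bar>"] abs_triangle_ineq4[of x y] by simp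
        with False show ?thesis by (simp add: log_dist_def ennreal_leI del: ennreal_plus)
      qed (simp add: log_dist_def e2ennreal_neg)
    qed
    also have "\<dots> < \<infinity>" using ab by (auto simp: real_integrable_def less_top)
    finally have "ext_integral (\<nu> \<Otimes>\<^sub>M \<nu>) (\<lambda>(x, y). log_dist x y) = - \<infinity>"
      unfolding ext_integral_def using n
      by (cases "\<integral>\<^sup>+p. e2ennreal (case p of (x, y) \<Rightarrow> log_dist x y) \<partial>(\<nu> \<Otimes>\<^sub>M \<nu>)") auto
    moreover have "ext_integral \<nu> (\<lambda>x. ereal (V x)) = ereal (\<integral>x. V x \<partial>\<nu>)"
      by (rule ext_integral_eq_integral[OF int]) simp
    ultimately show False using J by (simp add: J_def)
  qed
  with \<nu> id show "log_finite \<nu>" by (simp add: log_finite_def less_top)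
qed

lemma ennreal_power2_add_le: "(x + y)\<^sup>2 \<le> 2 * x\<^sup>2 + 2 * (y\<^sup>2 :: ennreal)"
proof (cases x; cases y)
  fix r s assume rs: "x = ennreal r" "0 \<le> r" "y = ennreal s" "0 \<le> s"
  have "(r + s)\<^sup>2 \<le> 2 * r\<^sup>2 + 2 * s\<^sup>2"
    using zero_le_power2[of "r - s"] by (simp add: power2_sum power2_diff)
  then have "ennreal ((r + s)\<^sup>2) \<le> ennreal (2 * r\<^sup>2 + 2 * s\<^sup>2)" by (rule ennreal_leI)
  moreover have "2 = ennreal 2" by simp
  ultimately show ?thesis using rs
    by (simp only: ennreal_plus[symmetric] ennreal_power ennreal_mult[symmetric] add_nonneg_nonneg
        zero_le_power2 zero_le_numeral mult_nonneg_nonneg)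
qed (auto simp: power2_eq_square ennreal_mult_top ennreal_top_mult)

section \<open>First variation at an equilibrium measure\<close>

text \<open>About \<mu> only minimality is assumed. That it lives on a bounded interval and that it
  is the only minimizer is derived within the locale.\<close>

locale equilibrium =
  fixes V :: "real \<Rightarrow> real" and a b :: real and \<mu> :: "real measure"
  assumes V: "continuous_on UNIV V"
    and a: "0 < a" and b: "0 \<le> b"
    and growth: "\<And>x. a * x\<^sup>2 - b \<le> V x"
    and equilibrium: "is_equilibrium_measure V \<mu>"
begin

lemma real_distribution_\<mu>: "real_distribution \<mu>"
  using equilibrium by (simp add: is_equilibrium_measure_def)

lemma log_finite_\<mu>: "log_finite \<mu>" and integrable_\<mu>: "integrable \<mu> V"
  using J_finite_imp[OF real_distribution_\<mu> V a b growth] equilibrium c_min_less_infinity[OF V]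
  by (auto simp: is_equilibrium_measure_def)

lemma c_min_eq: "c_min V = ereal ((\<integral>x. V x \<partial>\<mu>) - log_energy \<mu> \<mu>)"
  using equilibrium J_eq[OF log_finite_\<mu> integrable_\<mu>] by (simp add: is_equilibrium_measure_def)

text \<open>The one-sided derivative at \<open>t = 0\<close> of
  \<open>J V (mixture t \<nu> \<mu>)\<close>, for \<nu> of finite logarithmic energy that integrates
  \<open>V\<close>. The second-order coefficient is \<open>log_distance \<nu> \<mu>\<close>.\<close>

definition first_variation :: "real measure \<Rightarrow> real" where
  "first_variation \<nu> = (\<integral>x. V x \<partial>\<nu>) - (\<integral>x. V x \<partial>\<mu>) - 2 * log_energy \<nu> \<mu> + 2 * log_energy \<mu> \<mu>"

lemma free_entropy_eq:
  assumes "log_finite \<nu>" "integrable \<nu> V"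
  shows "free_entropy V \<nu> = ereal (first_variation \<nu> + log_distance \<nu> \<mu>)"
  unfolding free_entropy_def c_min_eq J_eq[OF assms]
  by (simp add: first_variation_def log_distance_def)

text \<open>Along the segment from \<mu> to \<nu>, \<open>J V\<close> changes by \<open>t\<close>
  times \<open>first_variation \<nu> + t * log_distance \<nu> \<mu>\<close>. Minimality makes this
  nonnegative, and a small \<open>t\<close> leaves only the linear term.\<close>

lemma first_variation_nonneg:
  assumes \<nu>: "log_finite \<nu>" "integrable \<nu> V"
  shows "0 \<le> first_variation \<nu>"
proof (rule ccontr)
  assume neg: "\<not> 0 \<le> first_variation \<nu>"
  let ?f = "first_variation \<nu>" and ?d = "log_distance \<nu> \<mu>"
  have d: "0 \<le> ?d" by (rule log_distance_ge(2)[OF \<nu>(1) log_finite_\<mu> order_refl])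
  \<comment> \<open>Makes the quadratic term at most half the size of the linear one. The summand 1
    keeps the denominator positive when \<open>?d = 0\<close>.\<close>
  define t where "t = min 1 (- ?f / (2 * (?d + 1)))"
  have t: "0 < t" "t \<le> 1" using neg d by (auto simp: t_def divide_neg_pos)
  let ?m = "mixture t \<nu> \<mu>"
  have r: "real_distribution \<nu>" "real_distribution \<mu>" using \<nu> log_finite_\<mu> by (auto simp: log_finite_def)
  have m: "log_finite ?m" using t by (intro log_finite_mixture \<nu> log_finite_\<mu>) auto
  note rm = real_distribution_mixture[OF r, of t]
  have mV: "integrable ?m V" "(\<integral>x. V x \<partial>?m) = t * (\<integral>x. V x \<partial>\<nu>) + (1 - t) * (\<integral>x. V x \<partial>\<mu>)"
    by (rule integral_of_nn_integral_combination[of ?m t \<nu> "1 - t" \<mu>];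
        use t \<nu>(2) integrable_\<mu> r nn_integral_mixture[OF r, of t] rm in
        \<open>auto simp: real_distribution.events_eq_borel cong: measurable_cong_sets\<close>)+
  have "c_min V \<le> J V ?m"
    unfolding c_min_def using m by (intro INF_lower) (simp add: log_finite_def)
  then have "(\<integral>x. V x \<partial>\<mu>) - log_energy \<mu> \<mu> \<le> (\<integral>x. V x \<partial>?m) - log_energy ?m ?m"
    unfolding c_min_eq J_eq[OF m mV(1)] by simp
  moreover have "log_energy ?m ?m
      = t\<^sup>2 * log_energy \<nu> \<nu> + 2 * t * (1 - t) * log_energy \<nu> \<mu> + (1 - t)\<^sup>2 * log_energy \<mu> \<mu>"
    using t by (intro log_energy_mixture \<nu> log_finite_\<mu>) auto
  ultimately have "0 \<le> t * (?f + t * ?d)"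
    unfolding mV(2) first_variation_def log_distance_def
    by (simp add: power2_eq_square algebra_simps)
  then have "0 \<le> ?f + t * ?d" using t by (simp add: zero_le_mult_iff)
  moreover have "t * ?d \<le> - ?f / 2"
  proof -
    have "t * ?d \<le> (- ?f / (2 * (?d + 1))) * (?d + 1)"
      using t d neg by (intro mult_mono) (auto simp: t_def divide_nonpos_pos)
    also have "\<dots> = - ?f / 2" using d by (simp add: field_simps)
    finally show ?thesis .
  qed
  ultimately show False using neg by simp
qed

text \<open>The integrand that represents \<open>first_variation\<close> as a linear functional of
  \<nu>. The constant is chosen so that the integral against \<mu> itself is 0.\<close>

definition effective_potential :: "real \<Rightarrow> real" where
  "effective_potential x = V x - 2 * (\<integral>y. ln \<bar>x - y\<bar> \<partial>\<mu>)
     - ((\<integral>x. V x \<partial>\<mu>) - 2 * log_energy \<mu> \<mu>)"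

lemma integral_effective_potential:
  assumes \<nu>: "log_finite \<nu>" "integrable \<nu> V"
  shows "integrable \<nu> effective_potential" "(\<integral>x. effective_potential x \<partial>\<nu>) = first_variation \<nu>"
proof -
  interpret N: real_distribution \<nu> using \<nu> by (simp add: log_finite_def)
  interpret M: real_distribution \<mu> by (rule real_distribution_\<mu>)
  interpret P: pair_sigma_finite \<nu> \<mu> ..
  have i: "integrable (\<nu> \<Otimes>\<^sub>M \<mu>) (\<lambda>(x, y). ln \<bar>x - y\<bar>)"
    using integrable_ln_pair[OF \<nu>(1) log_finite_\<mu>] by (simp add: split_beta')
  have U: "integrable \<nu> (\<lambda>x. \<integral>y. ln \<bar>x - y\<bar> \<partial>\<mu>)"
    using P.integrable_fst[OF i] .
  have "(\<integral>x. (\<integral>y. ln \<bar>x - y\<bar> \<partial>\<mu>) \<partial>\<nu>) = log_energy \<nu> \<mu>"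
    using P.integral_fst[OF i] by (simp add: log_energy_def split_beta')
  with U \<nu>(2) show "integrable \<nu> effective_potential" "(\<integral>x. effective_potential x \<partial>\<nu>) = first_variation \<nu>"
    unfolding effective_potential_def[abs_def] first_variation_def by (auto simp: N.prob_space[simplified])
qed

text \<open>The logarithmic potential of \<mu> grows at most linearly, since
  \<open>ln \<bar>x - y\<bar> \<le> \<bar>x\<bar> + \<bar>y\<bar>\<close>. Half of the quadratic
  growth of \<open>V\<close> pays for it far out.\<close>

lemma effective_potential_growth:
  obtains R where "1 \<le> R" "\<And>x. R < \<bar>x\<bar> \<Longrightarrow> a / 2 * x\<^sup>2 \<le> effective_potential x"
proof -
  interpret M: real_distribution \<mu> by (rule real_distribution_\<mu>)
  define K where "K = (\<integral>y. \<bar>y\<bar> \<partial>\<mu>)"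
  have abs: "integrable \<mu> abs" using log_finite_\<mu> by (simp add: log_finite_def)
  have U: "(\<integral>y. ln \<bar>x - y\<bar> \<partial>\<mu>) \<le> \<bar>x\<bar> + K" for x
  proof -
    have "(\<integral>y. ln \<bar>x - y\<bar> \<partial>\<mu>) \<le> (\<integral>y. \<bar>x\<bar> + \<bar>y\<bar> \<partial>\<mu>)"
    proof (rule integral_mono')
      fix y
      show "ln \<bar>x - y\<bar> \<le> \<bar>x\<bar> + \<bar>y\<bar>"
        using ln_le_minus_one[of "\<bar>x - y\<bar>"] abs_triangle_ineq4[of x y] by (cases "x = y") auto
    qed (use abs in auto)
    then show ?thesis using abs by (simp add: K_def M.prob_space[simplified])
  qed
  define D where "D = \<bar>b + 2 * K + ((\<integral>x. V x \<partial>\<mu>) - 2 * log_energy \<mu> \<mu>)\<bar>"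
  \<comment> \<open>Beyond \<open>R\<close> one has
    \<open>2 + D \<le> a / 2 * \<bar>x\<bar>\<close>, so half of the quadratic term absorbs
    \<open>2 * \<bar>x\<bar> + D\<close>.\<close>
  define R where "R = max 1 ((2 + D) * 2 / a)"
  show thesis
  proof (rule that)
    show "1 \<le> R" by (simp add: R_def)
    fix x assume x: "R < \<bar>x\<bar>"
    then have x1: "1 \<le> \<bar>x\<bar>" and "(2 + D) * 2 / a \<le> \<bar>x\<bar>" by (auto simp: R_def)
    then have "2 + D \<le> a / 2 * \<bar>x\<bar>" using a by (simp add: field_simps)
    then have "(2 + D) * \<bar>x\<bar> \<le> a / 2 * \<bar>x\<bar> * \<bar>x\<bar>" by (rule mult_right_mono) simp
    also have "\<dots> = a / 2 * x\<^sup>2" by (simp add: power2_eq_square)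
    finally have "(2 + D) * \<bar>x\<bar> \<le> a / 2 * x\<^sup>2" .
    moreover have "D * 1 \<le> D * \<bar>x\<bar>" using x1 by (intro mult_left_mono) (auto simp: D_def)
    ultimately have "2 * \<bar>x\<bar> + D \<le> a / 2 * x\<^sup>2" by (simp add: algebra_simps)
    then show "a / 2 * x\<^sup>2 \<le> effective_potential x"
      using U[of x] growth[of x] abs_ge_self[of "b + 2 * K + ((\<integral>x. V x \<partial>\<mu>) - 2 * log_energy \<mu> \<mu>)"]
      unfolding effective_potential_def D_def by linarith
  qed
qed

text \<open>On \<open>{-R..R}\<close> no pointwise sign of \<open>effective_potential\<close> is
  used, only its sign on average: that integral is, up to a positive factor, the first variation at
  \<nu> conditioned on \<open>{-R..R}\<close>.\<close>

lemma tail_le_first_variation: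
  assumes R: "1 \<le> R" "\<And>x. R < \<bar>x\<bar> \<Longrightarrow> a / 2 * x\<^sup>2 \<le> effective_potential x"
    and \<nu>: "log_finite \<nu>" "integrable \<nu> V"
  shows "a / 2 * (\<integral>x. indicator (- {-R..R}) x * x\<^sup>2 \<partial>\<nu>) \<le> first_variation \<nu>"
proof -
  let ?S = "{-R..R}" and ?W = effective_potential
  have r: "real_distribution \<nu>" using \<nu> by (simp add: log_finite_def)
  interpret N: real_distribution \<nu> by fact
  have W: "integrable \<nu> ?W" by (rule integral_effective_potential[OF \<nu>])
  have "0 \<le> (\<integral>x. indicator ?S x * ?W x \<partial>\<nu>)"
  proof (cases "measure \<nu> ?S = 0")
    \<comment> \<open>Here conditioning is impossible, but the integral is over a null set.\<close>
    case True
    then have "AE x in \<nu>. x \<notin> ?S"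
      by (intro AE_not_in) (auto simp: null_sets_def N.emeasure_eq_measure)
    then have "(\<integral>x. indicator ?S x * ?W x \<partial>\<nu>) = (\<integral>x. 0 \<partial>\<nu>)"
      using W by (intro integral_cong_AE) (auto intro!: borel_measurable_times)
    then show ?thesis by simp
  next
    case False
    then have pos: "0 < measure \<nu> ?S" by (simp add: zero_less_measure_iff)
    note u = log_finite_uniform_measure[OF \<nu>(1) _ pos]
    have "0 \<le> first_variation (uniform_measure \<nu> ?S)"
      by (intro first_variation_nonneg u \<nu>(2)) auto
    also have "\<dots> = (\<integral>x. ?W x \<partial>uniform_measure \<nu> ?S)"
      by (subst integral_effective_potential) (auto intro!: u \<nu>(2))
    also have "\<dots> = (\<integral>x. indicator ?S x * ?W x \<partial>\<nu>) / measure \<nu> ?S"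
      by (intro u W) auto
    finally show ?thesis using pos by (simp add: zero_le_divide_iff)
  qed
  moreover have i: "integrable \<nu> (\<lambda>x. indicator ?S x * ?W x)" "integrable \<nu> (\<lambda>x. indicator (- ?S) x * ?W x)"
    "integrable \<nu> (\<lambda>x. indicator (- ?S) x * x\<^sup>2)"
    using integrable_mult_indicator[OF _ W] integrable_mult_indicator[OF _ integrable_square_of_growth[OF r \<nu>(2) a growth]]
    by auto
  have "first_variation \<nu> = (\<integral>x. indicator ?S x * ?W x + indicator (- ?S) x * ?W x \<partial>\<nu>)"
    unfolding integral_effective_potential(2)[OF \<nu>, symmetric]
    by (intro Bochner_Integration.integral_cong) (auto simp: indicator_def)
  then have "first_variation \<nu> = (\<integral>x. indicator ?S x * ?W x \<partial>\<nu>) + (\<integral>x. indicator (- ?S) x * ?W x \<partial>\<nu>)"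
    using i by simp
  moreover have "(\<integral>x. a / 2 * (indicator (- ?S) x * x\<^sup>2) \<partial>\<nu>) \<le> (\<integral>x. indicator (- ?S) x * ?W x \<partial>\<nu>)"
    using i R(2) by (intro integral_mono) (auto simp: indicator_def abs_if)
  ultimately show ?thesis by simp
qed

end

section \<open>Distribution functions\<close>

lemma (in prob_space) nn_integral_power2_le:
  assumes [measurable]: "f \<in> borel_measurable M"
  shows "(\<integral>\<^sup>+x. f x \<partial>M)\<^sup>2 \<le> (\<integral>\<^sup>+x. (f x)\<^sup>2 \<partial>M)"
  using Cauchy_Schwarz_nn_integral[of f M "\<lambda>_. 1"] emeasure_space_1 by simp

lemma (in real_distribution) tail_prob_le_second_moment:
  assumes R: "1 \<le> R" and sq: "integrable M (\<lambda>x. x\<^sup>2)"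
  shows "measure M (- {-R..R}) \<le> (\<integral>x. indicator (- {-R..R}) x * x\<^sup>2 \<partial>M)"
proof -
  have "measure M (- {-R..R}) = (\<integral>x. indicator (- {-R..R}) x \<partial>M)" by simp
  also have "\<dots> \<le> (\<integral>x. indicator (- {-R..R}) x * x\<^sup>2 \<partial>M)"
  proof (rule integral_mono)
    show "integrable M (\<lambda>x. indicator (- {-R..R}) x * x\<^sup>2)"
      using integrable_mult_indicator[OF _ sq, of "- {-R..R}"] by simp
    fix x
    show "indicator (- {-R..R}) x \<le> indicator (- {-R..R}) x * x\<^sup>2"
    proof (cases "x \<in> {-R..R}")
      case False
      then have "1 \<le> \<bar>x\<bar>" using R by auto
      then have "1 \<le> x\<^sup>2" using power_mono[of 1 "\<bar>x\<bar>" 2] by simp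
      with False show ?thesis by simp
    qed simp
  qed (simp add: emeasure_eq_measure)
  finally show ?thesis .
qed

text \<open>The first inequality is strict because an atom at \<open>- R\<close> counts in
  \<open>cdf M (- R)\<close> but lies in \<open>{-R..R}\<close>.\<close>

lemma (in real_distribution) cdf_tail_le:
  shows "x < - R \<Longrightarrow> cdf M x \<le> measure M (- {-R..R})"
    and "R \<le> x \<Longrightarrow> 1 - cdf M x \<le> measure M (- {-R..R})"
proof -
  show "cdf M x \<le> measure M (- {-R..R})" if "x < - R"
    unfolding cdf_def using that by (intro finite_measure_mono) auto
  assume "R \<le> x"
  have "1 - cdf M x = measure M (space M - {..x})"
    unfolding cdf_def by (subst prob_compl) auto
  also have "\<dots> \<le> measure M (- {-R..R})"
    using \<open>R \<le> x\<close> by (intro finite_measure_mono) auto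
  finally show "1 - cdf M x \<le> measure M (- {-R..R})" .
qed

section \<open>Bounding the \<open>L\<^sup>1\<close> norm of the difference of distribution
  functions\<close>

context
  fixes \<mu> \<nu> :: "real measure" and R :: real
  assumes \<mu>: "log_finite \<mu>" and \<nu>: "log_finite \<nu>"
    and R: "1 \<le> R" and supp: "measure \<mu> (- {-R..R}) = 0"
begin

interpretation M: real_distribution \<mu> using \<mu> by (simp add: log_finite_def)
interpretation N: real_distribution \<nu> using \<nu> by (simp add: log_finite_def)

abbreviation (input) \<tau> :: real where "\<tau> \<equiv> measure \<nu> (- {-R..R})"
abbreviation (input) H :: "real \<Rightarrow> real" where "H \<equiv> (\<lambda>x. cdf \<nu> x - cdf \<mu> x)"

lemma cdf_\<mu>: "x < - R \<Longrightarrow> cdf \<mu> x = 0" "R \<le> x \<Longrightarrow> cdf \<mu> x = 1"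
  using M.cdf_tail_le(1)[of x R] M.cdf_tail_le(2)[of R x] M.cdf_nonneg[of x] M.cdf_bounded_prob[of x] supp
  by simp_all

lemma measurable_H: "H \<in> borel_measurable borel"
  using borel_measurable_cdf[OF M.real_distribution_axioms] borel_measurable_cdf[OF N.real_distribution_axioms]
  by measurable

text \<open>The square of \<tau> is weakened to \<tau>, using \<open>\<tau> \<le> 1\<close>, because
  the final estimate is linear in the tail.\<close>

lemma power2_H_tail: "R \<le> x \<Longrightarrow> (H x)\<^sup>2 \<le> \<tau>"
proof -
  assume x: "R \<le> x"
  then have "\<bar>H x\<bar> \<le> \<tau>"
    using N.cdf_tail_le(2)[of R x] N.cdf_bounded_prob[of x] cdf_\<mu>(2)[of x] by (simp add: abs_if)
  then have "(H x)\<^sup>2 \<le> \<tau>\<^sup>2" using power_mono[of "\<bar>H x\<bar>" \<tau> 2] by simp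
  also have "\<dots> \<le> \<tau> * 1"
    unfolding power2_eq_square by (intro mult_left_mono N.prob_le_1) simp
  finally show ?thesis by simp
qed

text \<open>Each \<open>H z\<close> is compared with \<open>H (z + r)\<close> for all
  \<open>r\<close> that carry \<open>z\<close> into the interval from \<open>R\<close> to
  \<open>2 * R\<close>, a set of shifts of length \<open>R\<close>. The increments are paid for by
  \<open>log_distance\<close>, the values \<open>H (z + r)\<close> by \<tau>; dividing by
  \<open>R\<close> leaves the stated constants.\<close>

lemma nn_integral_square_H_le:
  "(\<integral>\<^sup>+z. ennreal ((H z)\<^sup>2) * indicator {-R..R} z \<partial>lborel) \<le> ennreal (18 * R * log_distance \<nu> \<mu> + 4 * R * \<tau>)"
proof -
  \<comment> \<open>Since \<open>z\<close> is in \<open>{-R..R}\<close>, the shifts selected by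
    \<open>G\<close> below satisfy \<open>0 < r < 3 * R\<close>; hence the truncation of
    \<open>w\<close> at \<open>3 * R\<close>.\<close>
  define w where "w = (\<lambda>(r, z). indicator {0<..<3 * R} r / r\<^sup>2 * (incr \<nu> r z - incr \<mu> r z)\<^sup>2)"
  define G where "G = (\<lambda>(r, z). indicator {-R..R} z * indicator {R - z<..<2 * R - z} r :: real)"
  note measurable_H[measurable]
  note borel_measurable_incr[OF M.real_distribution_axioms, measurable]
    borel_measurable_incr[OF N.real_distribution_axioms, measurable]
  have [measurable]: "w \<in> borel_measurable (lborel \<Otimes>\<^sub>M lborel)"
    unfolding w_def by measurable
  have mG[measurable]: "G \<in> borel_measurable (lborel \<Otimes>\<^sub>M lborel)"
    unfolding G_def by (simp add: indicator_def[abs_def] split_beta')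
  have w0: "0 \<le> w p" for p by (auto simp: w_def split_beta')
  have G0: "0 \<le> G p" for p by (auto simp: G_def split_beta')
  have d0: "0 \<le> log_distance \<nu> \<mu>" by (rule log_distance_ge(2)[OF \<nu> \<mu> order_refl])
  have pt: "G (r, z) * (H z)\<^sup>2 \<le> 18 * R\<^sup>2 * w (r, z) + G (r, z) * (2 * \<tau>)" for r z
  proof (cases "z \<in> {-R..R} \<and> r \<in> {R - z<..<2 * R - z}")
    case True
    then have r: "0 < r" "r < 3 * R" and zr: "R \<le> z + r" by auto
    \<comment> \<open>The difference of the two sides is the square of
      \<open>2 * H (z + r) - H z\<close>.\<close>
    have "(H z)\<^sup>2 \<le> 2 * (H (z + r) - H z)\<^sup>2 + 2 * (H (z + r))\<^sup>2"
      using zero_le_power2[of "2 * H (z + r) - H z"] by (simp add: power2_diff power2_eq_square algebra_simps)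
    also have "2 * (H (z + r))\<^sup>2 \<le> 2 * \<tau>" using power2_H_tail[OF zr] by simp
    also have "2 * (H (z + r) - H z)\<^sup>2 = 2 * (incr \<nu> r z - incr \<mu> r z)\<^sup>2"
      unfolding incr_def by (simp add: algebra_simps)
    also have "\<dots> \<le> 18 * R\<^sup>2 * w (r, z)"
    proof -
      have "r\<^sup>2 \<le> (3 * R)\<^sup>2" using r by (intro power_mono) auto
      then have "1 \<le> 9 * R\<^sup>2 / r\<^sup>2" using r by (simp add: power_mult_distrib)
      then have "2 * (incr \<nu> r z - incr \<mu> r z)\<^sup>2 * 1 \<le> 2 * (incr \<nu> r z - incr \<mu> r z)\<^sup>2 * (9 * R\<^sup>2 / r\<^sup>2)"
        by (intro mult_left_mono) auto
      then show ?thesis using r by (simp add: w_def field_simps)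
    qed
    finally show ?thesis using True by (simp add: G_def)
  next
    case False
    then show ?thesis using w0[of "(r, z)"] by (auto simp: G_def)
  qed
  \<comment> \<open>Each \<open>z\<close> has admissible shifts of total length \<open>R\<close>,
    which is the factor in front of the integral of \<open>(H z)\<^sup>2\<close> below.\<close>
  have iG: "(\<integral>\<^sup>+r. ennreal (G (r, z)) \<partial>lborel) = ennreal R * indicator {-R..R} z" for z
  proof -
    have "(\<integral>\<^sup>+r. ennreal (G (r, z)) \<partial>lborel) = (\<integral>\<^sup>+r. indicator {-R..R} z * indicator {R - z<..<2 * R - z} r \<partial>lborel)"
      by (intro nn_integral_cong) (simp add: G_def ennreal_mult ennreal_indicator)
    also have "\<dots> = ennreal R * indicator {-R..R} z"
      using R by (subst nn_integral_cmult) (auto simp: mult.commute)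
    finally show ?thesis .
  qed
  have "ennreal R * (\<integral>\<^sup>+z. ennreal ((H z)\<^sup>2) * indicator {-R..R} z \<partial>lborel)
      = (\<integral>\<^sup>+z. (\<integral>\<^sup>+r. ennreal (G (r, z)) * ennreal ((H z)\<^sup>2) \<partial>lborel) \<partial>lborel)"
    by (simp add: nn_integral_multc iG nn_integral_cmult[symmetric] ac_simps)
  also have "\<dots> \<le> (\<integral>\<^sup>+z. (\<integral>\<^sup>+r. ennreal (18 * R\<^sup>2) * ennreal (w (r, z)) + ennreal (2 * \<tau>) * ennreal (G (r, z)) \<partial>lborel) \<partial>lborel)"
  proof (intro nn_integral_mono)
    fix r z
    show "ennreal (G (r, z)) * ennreal ((H z)\<^sup>2) \<le> ennreal (18 * R\<^sup>2) * ennreal (w (r, z)) + ennreal (2 * \<tau>) * ennreal (G (r, z))"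
      using ennreal_leI[OF pt[of r z]] w0[of "(r, z)"] G0[of "(r, z)"]
      by (simp add: ennreal_mult[symmetric] mult.commute)
  qed
  also have "\<dots> = ennreal (18 * R\<^sup>2) * (\<integral>\<^sup>+z. (\<integral>\<^sup>+r. ennreal (w (r, z)) \<partial>lborel) \<partial>lborel)
      + ennreal (2 * \<tau>) * (\<integral>\<^sup>+z. (\<integral>\<^sup>+r. ennreal (G (r, z)) \<partial>lborel) \<partial>lborel)"
    by (simp add: nn_integral_add nn_integral_cmult)
  also have "(\<integral>\<^sup>+z. (\<integral>\<^sup>+r. ennreal (w (r, z)) \<partial>lborel) \<partial>lborel) = (\<integral>\<^sup>+p. ennreal (w p) \<partial>(lborel \<Otimes>\<^sub>M lborel))"
    by (subst lborel_pair.nn_integral_snd[symmetric]) auto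
  also have "\<dots> \<le> ennreal (log_distance \<nu> \<mu>)"
    using log_distance_ge(1)[OF \<nu> \<mu>, of "3 * R"] R by (simp add: w_def split_beta')
  also have "(\<integral>\<^sup>+z. (\<integral>\<^sup>+r. ennreal (G (r, z)) \<partial>lborel) \<partial>lborel) = ennreal R * ennreal (2 * R)"
    unfolding iG using R by (simp add: nn_integral_cmult)
  also have "ennreal (18 * R\<^sup>2) * ennreal (log_distance \<nu> \<mu>) + ennreal (2 * \<tau>) * (ennreal R * ennreal (2 * R))
      = ennreal R * ennreal (18 * R * log_distance \<nu> \<mu> + 4 * R * \<tau>)"
    using R d0 by (simp add: ennreal_mult[symmetric] ennreal_plus[symmetric] del: ennreal_plus)
      (simp add: power2_eq_square algebra_simps)
  finally have le: "ennreal R * (\<integral>\<^sup>+z. ennreal ((H z)\<^sup>2) * indicator {-R..R} z \<partial>lborel)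
      \<le> ennreal R * ennreal (18 * R * log_distance \<nu> \<mu> + 4 * R * \<tau>)"
    by (simp add: add_right_mono mult_left_mono)
  then show ?thesis using R by (simp add: ennreal_mult_le_mult_iff)
qed

text \<open>Outside \<open>{-R..R}\<close>, where \<open>cdf \<mu>\<close> is 0 or 1,
  \<open>\<bar>H x\<bar>\<close> is a tail probability of \<nu>. Exchanging integrals, each
  \<open>y\<close> contributes its distance to \<open>{-R..R}\<close>, which is at most
  \<open>\<bar>y\<bar>\<close>.\<close>

lemma nn_integral_tail_H_le:
  "(\<integral>\<^sup>+x. ennreal \<bar>H x\<bar> * indicator (- {-R..R}) x \<partial>lborel) \<le> (\<integral>\<^sup>+y. ennreal \<bar>y\<bar> * indicator (- {-R..R}) y \<partial>\<nu>)"
proof -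
  have [measurable_cong]: "sets \<nu> = sets borel" by simp
  interpret P: pair_sigma_finite lborel \<nu> ..
  \<comment> \<open>The strict and non-strict comparisons match the tails \<open>{x<..}\<close> on
    the right and \<open>{..x}\<close> on the left.\<close>
  define k where "k x y = (if R < x \<and> x < y \<or> y \<le> x \<and> x < - R then 1 else 0 :: ennreal)" for x y
  have [measurable]: "(\<lambda>(x, y). k x y) \<in> borel_measurable (lborel \<Otimes>\<^sub>M \<nu>)"
    unfolding k_def by measurable
  have "ennreal \<bar>H x\<bar> * indicator (- {-R..R}) x \<le> (\<integral>\<^sup>+y. k x y \<partial>\<nu>)" for x
  proof -
    consider "x < - R" | "R < x" | "x \<in> {-R..R}" by fastforce
    then show ?thesis
    proof cases
      case 1
      then have "(\<integral>\<^sup>+y. k x y \<partial>\<nu>) = (\<integral>\<^sup>+y. indicator {..x} y \<partial>\<nu>)"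
        using R by (intro nn_integral_cong) (auto simp: k_def indicator_def)
      then show ?thesis using 1 by (simp add: cdf_\<mu>(1) N.emeasure_eq_measure cdf_def[of \<nu>])
    next
      case 2
      then have "(\<integral>\<^sup>+y. k x y \<partial>\<nu>) = (\<integral>\<^sup>+y. indicator {x<..} y \<partial>\<nu>)"
        using R by (intro nn_integral_cong) (auto simp: k_def indicator_def)
      also have "\<dots> = ennreal (measure \<nu> (space \<nu> - {..x}))"
        by (subst nn_integral_indicator) (auto simp: N.emeasure_eq_measure Compl_eq_Diff_UNIV[symmetric] not_le
            intro!: arg_cong[where f="measure \<nu>"])
      also have "measure \<nu> (space \<nu> - {..x}) = 1 - cdf \<nu> x"
        unfolding cdf_def by (subst N.prob_compl) auto
      finally show ?thesis using 2 N.cdf_bounded_prob[of x] by (simp add: cdf_\<mu>)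
    qed simp
  qed
  then have "(\<integral>\<^sup>+x. ennreal \<bar>H x\<bar> * indicator (- {-R..R}) x \<partial>lborel) \<le> (\<integral>\<^sup>+x. (\<integral>\<^sup>+y. k x y \<partial>\<nu>) \<partial>lborel)"
    by (intro nn_integral_mono)
  also have "\<dots> = (\<integral>\<^sup>+y. (\<integral>\<^sup>+x. k x y \<partial>lborel) \<partial>\<nu>)"
    by (rule P.Fubini'[symmetric]) measurable
  also have "\<dots> \<le> (\<integral>\<^sup>+y. ennreal \<bar>y\<bar> * indicator (- {-R..R}) y \<partial>\<nu>)"
  proof (rule nn_integral_mono)
    fix y
    consider "y < - R" | "R < y" | "y \<in> {-R..R}" by fastforce
    then show "(\<integral>\<^sup>+x. k x y \<partial>lborel) \<le> ennreal \<bar>y\<bar> * indicator (- {-R..R}) y"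
    proof cases
      case 1
      then have "(\<integral>\<^sup>+x. k x y \<partial>lborel) = (\<integral>\<^sup>+x. indicator {y..<-R} x \<partial>lborel)"
        using R by (intro nn_integral_cong) (auto simp: k_def indicator_def)
      then show ?thesis using 1 R by (simp add: ennreal_leI)
    next
      case 2
      then have "(\<integral>\<^sup>+x. k x y \<partial>lborel) = (\<integral>\<^sup>+x. indicator {R<..<y} x \<partial>lborel)"
        using R by (intro nn_integral_cong) (auto simp: k_def indicator_def)
      then show ?thesis using 2 R by (simp add: ennreal_leI)
    next
      case 3
      then have "(\<integral>\<^sup>+x. k x y \<partial>lborel) = (\<integral>\<^sup>+x. 0 \<partial>(lborel :: real measure))"
        using R by (intro nn_integral_cong) (auto simp: k_def)
      then show ?thesis by simp
    qed
  qed
  finally show ?thesis .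
qed

text \<open>Cauchy-Schwarz on both parts: inside against Lebesgue measure on an interval of length
  \<open>2 * R\<close>, outside against the probability measure \<nu>. The squares are joined by
  \<open>ennreal_power2_add_le\<close>, and \<open>\<tau> \<le> T\<close> merges the tail
  terms.\<close>

lemma nn_integral_abs_H_power2_le:
  assumes sq: "integrable \<nu> (\<lambda>x. x\<^sup>2)"
  defines "T \<equiv> (\<integral>x. indicator (- {-R..R}) x * x\<^sup>2 \<partial>\<nu>)"
  shows "(\<integral>\<^sup>+x. ennreal \<bar>H x\<bar> \<partial>lborel)\<^sup>2
    \<le> ennreal (72 * R\<^sup>2 * log_distance \<nu> \<mu> + (16 * R\<^sup>2 + 2) * T)"
proof -
  have [measurable_cong]: "sets \<nu> = sets borel" by simp
  note measurable_H[measurable]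
  have iT: "integrable \<nu> (\<lambda>x. indicator (- {-R..R}) x * x\<^sup>2)"
    using integrable_mult_indicator[OF _ sq, of "- {-R..R}"] by simp
  have T0: "0 \<le> T" unfolding T_def by (rule integral_nonneg_AE) simp
  have d0: "0 \<le> log_distance \<nu> \<mu>" by (rule log_distance_ge(2)[OF \<nu> \<mu> order_refl])
  have \<tau>: "\<tau> \<le> T" unfolding T_def by (rule N.tail_prob_le_second_moment[OF R sq])
  \<comment> \<open>Repeating the indicator supplies the second factor for Cauchy-Schwarz.\<close>
  have "(\<integral>\<^sup>+x. ennreal \<bar>H x\<bar> * indicator {-R..R} x \<partial>lborel)\<^sup>2
      = (\<integral>\<^sup>+x. (ennreal \<bar>H x\<bar> * indicator {-R..R} x) * indicator {-R..R} x \<partial>lborel)\<^sup>2"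
    by (intro arg_cong[where f="\<lambda>x. x\<^sup>2"] nn_integral_cong) (simp add: indicator_def)
  also have "\<dots> \<le> (\<integral>\<^sup>+x. (ennreal \<bar>H x\<bar> * indicator {-R..R} x)\<^sup>2 \<partial>lborel) * (\<integral>\<^sup>+x. (indicator {-R..R} x)\<^sup>2 \<partial>lborel)"
    by (rule Cauchy_Schwarz_nn_integral) measurable
  also have "(\<integral>\<^sup>+x. (ennreal \<bar>H x\<bar> * indicator {-R..R} x)\<^sup>2 \<partial>lborel) = (\<integral>\<^sup>+z. ennreal ((H z)\<^sup>2) * indicator {-R..R} z \<partial>lborel)"
    by (intro nn_integral_cong) (simp add: indicator_def ennreal_power)
  also have "(\<integral>\<^sup>+x. (indicator {-R..R} x)\<^sup>2 \<partial>lborel) = (\<integral>\<^sup>+x. indicator {-R..R} x \<partial>lborel)"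
    by (intro nn_integral_cong) (simp add: indicator_def)
  also have "\<dots> = ennreal (2 * R)" using R by simp
  also have "(\<integral>\<^sup>+z. ennreal ((H z)\<^sup>2) * indicator {-R..R} z \<partial>lborel) * ennreal (2 * R)
      \<le> ennreal (18 * R * log_distance \<nu> \<mu> + 4 * R * \<tau>) * ennreal (2 * R)"
    by (intro mult_right_mono nn_integral_square_H_le) simp
  also have "\<dots> = ennreal (36 * R\<^sup>2 * log_distance \<nu> \<mu> + 8 * R\<^sup>2 * \<tau>)"
    using R d0 by (subst ennreal_mult[symmetric]) (simp_all add: power2_eq_square algebra_simps)
  finally have inner: "(\<integral>\<^sup>+x. ennreal \<bar>H x\<bar> * indicator {-R..R} x \<partial>lborel)\<^sup>2
      \<le> ennreal (36 * R\<^sup>2 * log_distance \<nu> \<mu> + 8 * R\<^sup>2 * \<tau>)" .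
  have "(\<integral>\<^sup>+x. ennreal \<bar>H x\<bar> * indicator (- {-R..R}) x \<partial>lborel)\<^sup>2 \<le> (\<integral>\<^sup>+y. ennreal \<bar>y\<bar> * indicator (- {-R..R}) y \<partial>\<nu>)\<^sup>2"
    by (intro power_mono nn_integral_tail_H_le) simp
  also have "\<dots> \<le> (\<integral>\<^sup>+y. (ennreal \<bar>y\<bar> * indicator (- {-R..R}) y)\<^sup>2 \<partial>\<nu>)"
    by (rule N.nn_integral_power2_le) measurable
  also have "\<dots> = (\<integral>\<^sup>+y. ennreal (indicator (- {-R..R}) y * y\<^sup>2) \<partial>\<nu>)"
    by (intro nn_integral_cong) (simp add: indicator_def ennreal_power)
  also have "\<dots> = ennreal T" unfolding T_def by (rule nn_integral_eq_integral[OF iT]) simp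
  finally have outer: "(\<integral>\<^sup>+x. ennreal \<bar>H x\<bar> * indicator (- {-R..R}) x \<partial>lborel)\<^sup>2 \<le> ennreal T" .
  let ?I = "\<integral>\<^sup>+x. ennreal \<bar>H x\<bar> * indicator {-R..R} x \<partial>lborel"
    and ?O = "\<integral>\<^sup>+x. ennreal \<bar>H x\<bar> * indicator (- {-R..R}) x \<partial>lborel"
  have "(\<integral>\<^sup>+x. ennreal \<bar>H x\<bar> \<partial>lborel)
      = (\<integral>\<^sup>+x. ennreal \<bar>H x\<bar> * indicator {-R..R} x + ennreal \<bar>H x\<bar> * indicator (- {-R..R}) x \<partial>lborel)"
    by (intro nn_integral_cong) (simp add: indicator_def)
  also have "\<dots> = ?I + ?O"
    by (rule nn_integral_add) measurable
  finally have split: "(\<integral>\<^sup>+x. ennreal \<bar>H x\<bar> \<partial>lborel) = ?I + ?O" .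
  have "(\<integral>\<^sup>+x. ennreal \<bar>H x\<bar> \<partial>lborel)\<^sup>2 \<le> 2 * ?I\<^sup>2 + 2 * ?O\<^sup>2"
    unfolding split by (rule ennreal_power2_add_le)
  also have "\<dots> \<le> 2 * ennreal (36 * R\<^sup>2 * log_distance \<nu> \<mu> + 8 * R\<^sup>2 * \<tau>) + 2 * ennreal T"
    by (rule add_mono[OF mult_left_mono[OF inner] mult_left_mono[OF outer]]) simp_all
  also have "\<dots> = ennreal (2 * (36 * R\<^sup>2 * log_distance \<nu> \<mu> + 8 * R\<^sup>2 * \<tau>) + 2 * T)"
  proof -
    have nn: "0 \<le> 36 * R\<^sup>2 * log_distance \<nu> \<mu> + 8 * R\<^sup>2 * \<tau>" using d0 by simp
    show ?thesis using nn T0 by (subst ennreal_plus) (auto simp only: ennreal_mult ennreal_numeral zero_le_numeral mult_nonneg_nonneg)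
  qed
  also have "\<dots> \<le> ennreal (72 * R\<^sup>2 * log_distance \<nu> \<mu> + (16 * R\<^sup>2 + 2) * T)"
  proof (rule ennreal_leI)
    have "16 * R\<^sup>2 * \<tau> \<le> 16 * R\<^sup>2 * T" using \<tau> by (intro mult_left_mono) auto
    then show "2 * (36 * R\<^sup>2 * log_distance \<nu> \<mu> + 8 * R\<^sup>2 * \<tau>) + 2 * T
        \<le> 72 * R\<^sup>2 * log_distance \<nu> \<mu> + (16 * R\<^sup>2 + 2) * T" by (simp add: algebra_simps)
  qed
  finally show ?thesis .
qed

end

section \<open>The transport inequality and uniqueness of the minimizer\<close>

context equilibrium
begin

text \<open>Kept in terms of distribution functions because it yields both the bound on
  \<open>W1\<close> and the uniqueness of \<mu>. The constant is uniform in \<nu>, as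
  \<open>R\<close> is fixed by \<open>V\<close> and \<mu>.\<close>

lemma nn_integral_cdf_diff_power2_le:
  "\<exists>B>0. \<forall>\<nu>. log_finite \<nu> \<longrightarrow> integrable \<nu> V \<longrightarrow>
    (\<integral>\<^sup>+x. ennreal \<bar>cdf \<nu> x - cdf \<mu> x\<bar> \<partial>lborel)\<^sup>2 \<le> ennreal (B * (first_variation \<nu> + log_distance \<nu> \<mu>))"
proof -
  obtain R where R: "1 \<le> R" "\<And>x. R < \<bar>x\<bar> \<Longrightarrow> a / 2 * x\<^sup>2 \<le> effective_potential x"
    using effective_potential_growth by blast
  interpret M: real_distribution \<mu> by (rule real_distribution_\<mu>)
  let ?T = "\<lambda>\<nu>. \<integral>x. indicator (- {-R..R}) x * x\<^sup>2 \<partial>\<nu>"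
  \<comment> \<open>The first variation vanishes at \<mu> itself, so \<mu> has no mass outside
    \<open>{-R..R}\<close>.\<close>
  have "a / 2 * ?T \<mu> \<le> 0"
    using tail_le_first_variation[OF R log_finite_\<mu> integrable_\<mu>] by (simp add: first_variation_def)
  then have T\<mu>: "?T \<mu> \<le> 0" using a by (simp add: mult_le_0_iff)
  have supp: "measure \<mu> (- {-R..R}) = 0"
    using T\<mu> measure_nonneg[of \<mu> "- {-R..R}"] M.tail_prob_le_second_moment[OF R(1)
      integrable_square_of_growth[OF real_distribution_\<mu> integrable_\<mu> a growth]]
    by linarith
  \<comment> \<open>The sum of the coefficient of \<open>log_distance\<close> and of the one that
    \<open>first_variation\<close> gets through
    \<open>?T \<nu> \<le> 2 / a * first_variation \<nu>\<close>. Both quantities are nonnegative, so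
    the sum serves for each.\<close>
  define B where "B = 72 * R\<^sup>2 + (16 * R\<^sup>2 + 2) * (2 / a)"
  show ?thesis
  proof (intro exI[of _ B] conjI allI impI)
    show "0 < B" unfolding B_def using R a by (intro add_pos_pos mult_pos_pos) auto
    fix \<nu> assume \<nu>: "log_finite \<nu>" "integrable \<nu> V"
    have d0: "0 \<le> log_distance \<nu> \<mu>" by (rule log_distance_ge(2)[OF \<nu>(1) log_finite_\<mu> order_refl])
    have f0: "0 \<le> first_variation \<nu>" by (rule first_variation_nonneg[OF \<nu>])
    have T: "?T \<nu> \<le> 2 / a * first_variation \<nu>"
      using tail_le_first_variation[OF R \<nu>] a by (simp add: field_simps)
    have sq: "integrable \<nu> (\<lambda>x. x\<^sup>2)"
      using \<nu> by (intro integrable_square_of_growth[OF _ \<nu>(2) a growth]) (simp add: log_finite_def)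
    have "(\<integral>\<^sup>+x. ennreal \<bar>cdf \<nu> x - cdf \<mu> x\<bar> \<partial>lborel)\<^sup>2
        \<le> ennreal (72 * R\<^sup>2 * log_distance \<nu> \<mu> + (16 * R\<^sup>2 + 2) * ?T \<nu>)"
      by (rule nn_integral_abs_H_power2_le[OF log_finite_\<mu> \<nu>(1) R(1) supp sq])
    also have "\<dots> \<le> ennreal (B * (first_variation \<nu> + log_distance \<nu> \<mu>))"
    proof (rule ennreal_leI)
      have "(16 * R\<^sup>2 + 2) * ?T \<nu> \<le> (16 * R\<^sup>2 + 2) * (2 / a * first_variation \<nu>)"
        using T by (intro mult_left_mono) auto
      moreover have "0 \<le> 72 * R\<^sup>2 * first_variation \<nu>" using f0 by simp
      moreover have "0 \<le> (16 * R\<^sup>2 + 2) * (2 / a) * log_distance \<nu> \<mu>" using d0 a by simp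
      ultimately show "72 * R\<^sup>2 * log_distance \<nu> \<mu> + (16 * R\<^sup>2 + 2) * ?T \<nu>
          \<le> B * (first_variation \<nu> + log_distance \<nu> \<mu>)"
        unfolding B_def distrib_left distrib_right by linarith
    qed
    finally show "(\<integral>\<^sup>+x. ennreal \<bar>cdf \<nu> x - cdf \<mu> x\<bar> \<partial>lborel)\<^sup>2
        \<le> ennreal (B * (first_variation \<nu> + log_distance \<nu> \<mu>))" .
  qed
qed

lemma W1_power2_le:
  "\<exists>B. \<forall>\<nu>. real_distribution \<nu> \<longrightarrow> enn2ereal ((W1 \<nu> \<mu>)\<^sup>2) \<le> ereal B * free_entropy V \<nu>"
proof -
  obtain B where B: "0 < B" "\<forall>\<nu>. log_finite \<nu> \<longrightarrow> integrable \<nu> V \<longrightarrow>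
    (\<integral>\<^sup>+x. ennreal \<bar>cdf \<nu> x - cdf \<mu> x\<bar> \<partial>lborel)\<^sup>2 \<le> ennreal (B * (first_variation \<nu> + log_distance \<nu> \<mu>))"
    using nn_integral_cdf_diff_power2_le by blast
  show ?thesis
  proof (intro exI[of _ B] allI impI)
    fix \<nu> assume \<nu>: "real_distribution \<nu>"
    show "enn2ereal ((W1 \<nu> \<mu>)\<^sup>2) \<le> ereal B * free_entropy V \<nu>"
    proof (cases "J V \<nu> = \<infinity>")
      \<comment> \<open>The right-hand side is \<open>\<infinity>\<close>, since
        \<open>c_min V\<close> is finite and \<open>B\<close> is positive.\<close>
      case True
      then show ?thesis using B(1) by (simp add: free_entropy_def c_min_eq)
    next
      case False
      note f = J_finite_imp[OF \<nu> V a b growth False]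
      have s0: "0 \<le> first_variation \<nu> + log_distance \<nu> \<mu>"
        using first_variation_nonneg[OF f] log_distance_ge(2)[OF f(1) log_finite_\<mu> order_refl] by simp
      have "(W1 \<nu> \<mu>)\<^sup>2 \<le> (\<integral>\<^sup>+x. ennreal \<bar>cdf \<nu> x - cdf \<mu> x\<bar> \<partial>lborel)\<^sup>2"
        by (intro power_mono W1_le_cdf \<nu> real_distribution_\<mu>) simp
      also have "\<dots> \<le> ennreal (B * (first_variation \<nu> + log_distance \<nu> \<mu>))" by (rule B(2)[rule_format, OF f])
      finally have "enn2ereal ((W1 \<nu> \<mu>)\<^sup>2) \<le> enn2ereal (ennreal (B * (first_variation \<nu> + log_distance \<nu> \<mu>)))"
        by (simp add: less_eq_ennreal.rep_eq)
      also have "\<dots> = ereal B * free_entropy V \<nu>"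
        unfolding free_entropy_eq[OF f] using s0 B(1) by (simp add: enn2ereal_ennreal)
      finally show ?thesis .
    qed
  qed
qed

text \<open>The constant obtained so far depends on \<mu>, while the theorem claims one constant for
  all equilibrium measures. A second minimizer has free entropy 0, so its distribution function
  agrees with that of \<mu> almost everywhere, hence everywhere.\<close>

lemma equilibrium_unique:
  assumes "is_equilibrium_measure V \<nu>"
  shows "\<nu> = \<mu>"
proof -
  \<comment> \<open>The locale, instantiated at the other minimizer, supplies its finite energy and
    the integrability of \<open>V\<close>.\<close>
  interpret \<nu>: equilibrium V a b \<nu>
    by unfold_locales (use V a b growth assms in auto)
  interpret N: real_distribution \<nu> by (rule \<nu>.real_distribution_\<mu>)
  interpret M: real_distribution \<mu> by (rule real_distribution_\<mu>)
  have "free_entropy V \<nu> = 0"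
    using assms unfolding free_entropy_def is_equilibrium_measure_def c_min_eq by simp
  then have s: "first_variation \<nu> + log_distance \<nu> \<mu> = 0"
    using free_entropy_eq[OF \<nu>.log_finite_\<mu> \<nu>.integrable_\<mu>] by (simp add: zero_ereal_def)
  note [measurable] = borel_measurable_cdf[OF real_distribution_\<mu>] borel_measurable_cdf[OF \<nu>.real_distribution_\<mu>]
  obtain B where B: "0 < B" "\<forall>\<nu>. log_finite \<nu> \<longrightarrow> integrable \<nu> V \<longrightarrow>
    (\<integral>\<^sup>+x. ennreal \<bar>cdf \<nu> x - cdf \<mu> x\<bar> \<partial>lborel)\<^sup>2 \<le> ennreal (B * (first_variation \<nu> + log_distance \<nu> \<mu>))"
    using nn_integral_cdf_diff_power2_le by blast
  from B(2)[rule_format, OF \<nu>.log_finite_\<mu> \<nu>.integrable_\<mu>]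
  have "(\<integral>\<^sup>+x. ennreal \<bar>cdf \<nu> x - cdf \<mu> x\<bar> \<partial>lborel) = 0" unfolding s by simp
  then have AE: "AE x in lborel. cdf \<nu> x - cdf \<mu> x = 0"
    by (subst (asm) nn_integral_0_iff_AE) auto
  \<comment> \<open>By right-continuity a difference at \<open>x\<close> would persist on an
    interval to the right of \<open>x\<close>, which has positive length.\<close>
  have "cdf \<nu> x = cdf \<mu> x" for x
  proof (rule ccontr)
    assume ne: "cdf \<nu> x \<noteq> cdf \<mu> x"
    have "((\<lambda>x. cdf \<nu> x - cdf \<mu> x) \<longlongrightarrow> cdf \<nu> x - cdf \<mu> x) (at_right x)"
      using N.cdf_is_right_cont[of x] M.cdf_is_right_cont[of x]
      unfolding continuous_within by (rule tendsto_diff)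
    then have "\<forall>\<^sub>F y in at_right x. cdf \<nu> y - cdf \<mu> y \<noteq> 0"
      using ne by (intro tendsto_imp_eventually_ne) auto
    then obtain c where c: "x < c" "\<And>y. x < y \<Longrightarrow> y < c \<Longrightarrow> cdf \<nu> y - cdf \<mu> y \<noteq> 0"
      unfolding eventually_at_right_field by blast
    have "AE y in lborel. y \<notin> {x<..<c}" using AE by eventually_elim (use c in auto)
    then have "emeasure lborel {x<..<c} = 0"
      by (subst (asm) AE_iff_measurable[of "{x<..<c}"]) auto
    with c(1) show False by simp
  qed
  then show ?thesis
    by (intro cdf_unique N.real_distribution_axioms M.real_distribution_axioms) auto
qed

end

theorem theorem1p3:
  fixes V :: "real \<Rightarrow> real"
  assumes "continuous_on UNIV V"
    and "Liminf at_infinity (\<lambda>x. ereal (V x / x\<^sup>2)) > 0"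
  shows "\<exists>B :: real. \<forall>\<mu>V. is_equilibrium_measure V \<mu>V \<longrightarrow>
           (\<forall>\<nu>. real_distribution \<nu> \<longrightarrow>
              enn2ereal ((W1 \<nu> \<mu>V)\<^sup>2) \<le> ereal B * free_entropy V \<nu>)"
proof (cases "\<exists>\<mu>. is_equilibrium_measure V \<mu>")
  \<comment> \<open>In the other case the claim is vacuous. Here the constant belonging to one
    equilibrium measure serves for all of them by uniqueness.\<close>
  case True
  then obtain \<mu> where \<mu>: "is_equilibrium_measure V \<mu>" ..
  obtain a b where ab: "0 < a" "0 \<le> b" "\<And>x. a * x\<^sup>2 - b \<le> V x"
    using potential_growth[OF assms] by blast
  interpret equilibrium V a b \<mu> by unfold_locales (use assms(1) ab \<mu> in auto)
  show ?thesis using W1_power2_le equilibrium_unique by blast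
qed blast

end
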